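(* Let $n\ge 2$ and let $\mathbf A$ be a real $n\times n$ matrix (the matrix of a linear operator $A:\mathbb R^n\to\mathbb R^n$) which is $\mathcal J$-sign-symmetric and irreducible, and suppose that its second compound matrix $\mathbf A^{(2)}$ is also $\mathcal J$-sign-symmetric and irreducible. Let $\mathcal J\subseteq\{1,\dots,n\}$ and $\widetilde{\mathcal J}\subseteq\{1,\dots,\binom n2\}$ be sets witnessing the $\mathcal J$-sign-symmetricity of $\mathbf A$ and of $\mathbf A^{(2)}$ respectively, and let $\widehat W(\mathcal J,\widetilde{\mathcal J})$ be the associated subset of $\{1,\dots,n\}\times\{1,\dots,n\}$. Then one of the following two cases takes place: (1) The set $\widehat W(\mathcal J,\widetilde{\mathcal J})$ is transitive. Then $h(A)=1$ (with no restriction on $h(A\wedge A)$), and $A$ has two positive simple eigenvalues $\lambda_1,\lambda_2$ such that, with the eigenvalues of $A$ suitably enumerated with multiplicity, $$\rho(A)=\lambda_1>\lambda_2\ge|\lambda_3|\ge\dots\ge|\lambda_n|.$$ If $h(A)=h(A\wedge A)=1$, then $\lambda_2$ is different in modulus from the other eigenvalues. If $h(A)=1$ and $h(A\wedge A)>1$, then $A$ has exactly $h(A\wedge A)$ eigenvalues $\lambda_2,\lambda_3,\dots,\lambda_{h(A\wedge A)+1}$ equal in modulus to $\lambda_2$, each of them is simple, and they coincide with the $h(A\wedge A)$-th roots of $\lambda_2^{h(A\wedge A)}$. (2) The set $\widehat W(\mathcal J,\widetilde{\mathcal J})$ is not transitive. Then $h(A)=h(A\wedge A)=3$, and there are exactly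 three eigenvalues of $A$ on the circle $|\lambda|=\rho(A)$; each of them is simple, and they coincide with the cube roots of $(\rho(A))^3$.
   Context: A real $m\times m$ matrix $\mathbf B=(b_{ij})$ is $\mathcal J$-sign-symmetric if there is a subset $\mathcal J\subseteq\{1,\dots,m\}$ (a witness) such that $b_{ij}\le 0$ whenever exactly one of $i,j$ belongs to $\mathcal J$, and $b_{ij}<0$ only if exactly one of $i,j$ belongs to $\mathcal J$. A matrix is reducible if some permutation matrix $\mathbf P$ gives $\mathbf P^{-1}\mathbf B\mathbf P=\begin{pmatrix}\mathbf B_1&0\\ \mathbf C&\mathbf B_2\end{pmatrix}$ with $\mathbf B_1,\mathbf B_2$ square (of positive size); otherwise it is irreducible. Convention: the $1\times1$ zero matrix is not regarded as irreducible. The second compound matrix $\mathbf A^{(2)}$ is the $\binom n2\times\binom n2$ matrix of minors $A\begin{pmatrix} i&j\\k&l\end{pmatrix}=a_{ik}a_{jl}-a_{il}a_{jk}$, with rows indexed by pairs $(i,j)$, $i<j$, and columns by pairs $(k,l)$, $k<l$, pairs being numbered $1,\dots,\binom n2$ in lexicographic order. It is the matrix of the exterior square $A\wedge A$ in the basis $\{e_i\wedge e_j\}_{i<j}$. $\rho$ denotes spectral radius; for $B=A$ or $B=A\wedge A$, $h(B)$ denotes the number of eigenvalues of $B$, counted with multiplicity, of modulus $\rho(B)$. The set $\widehat W(\mathcal J,\widetilde{\mathcal J})\subseteq\{1,\dots,n\}\times\{1,\dots,n\}$ contains all pairs $(i,i)$, and for $i\ne j$ a pair $(i,j)$ belongs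 to it if and only if one of the following holds: (a) $i<j$, the numbers $i,j$ are both in $\mathcal J$ or both in $\{1,\dots,n\}\setminus\mathcal J$, and the lexicographic number $\alpha$ of $(i,j)$ lies in $\widetilde{\mathcal J}$; (b) $i<j$, exactly one of $i,j$ lies in $\mathcal J$, and the lexicographic number $\alpha$ of $(i,j)$ does not lie in $\widetilde{\mathcal J}$; (c) $i>j$, the numbers $i,j$ are both in $\mathcal J$ or both in $\{1,\dots,n\}\setminus\mathcal J$, and the lexicographic number of $(j,i)$ does not lie in $\widetilde{\mathcal J}$; (d) $i>j$, exactly one of $i,j$ lies in $\mathcal J$, and the lexicographic number of $(j,i)$ lies in $\widetilde{\mathcal J}$. The set is called transitive if the binary relation $i\prec j\iff(i,j)\in\widehat W(\mathcal J,\widetilde{\mathcal J})$ is a linear order on $\{1,\dots,n\}$; since this relation is automatically reflexive, antisymmetric and connected, this amounts to the relation being transitive. *)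

theory Defs
  imports
    "Jordan_Normal_Form.Spectral_Radius"
    "HOL-Computational_Algebra.Fundamental_Theorem_Algebra"
    "HOL-Combinatorics.Permutations"
begin

text \<open>
  Rows and columns of matrices are numbered from 0, so index sets are subsets of \<open>{..<m}\<close>
  rather than of \<open>{1..m}\<close>; the same goes for the lexicographic numbers of pairs.
\<close>

definition sign_symmetric_witness :: "real mat \<Rightarrow> nat set \<Rightarrow> bool" where
  "sign_symmetric_witness B J \<longleftrightarrow>
     J \<subseteq> {..<dim_row B} \<and>
     (\<forall>i<dim_row B. \<forall>j<dim_row B.
        ((i \<in> J) \<noteq> (j \<in> J) \<longrightarrow> B $$ (i, j) \<le> 0) \<and>
        (B $$ (i, j) < 0 \<longrightarrow> (i \<in> J) \<noteq> (j \<in> J)))"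

definition J_sign_symmetric :: "real mat \<Rightarrow> bool" where
  "J_sign_symmetric B \<longleftrightarrow> (\<exists>J. sign_symmetric_witness B J)"

definition permutation_mat :: "nat \<Rightarrow> real mat \<Rightarrow> bool" where
  "permutation_mat m P \<longleftrightarrow>
     (\<exists>f. f permutes {..<m} \<and> P = mat m m (\<lambda>(i, j). if i = f j then 1 else 0))"

definition reducible_mat :: "real mat \<Rightarrow> bool" where
  "reducible_mat B \<longleftrightarrow>
     (\<exists>P Q k l B1 B2 C.
        permutation_mat (dim_row B) P \<and>
        Q \<in> carrier_mat (dim_row B) (dim_row B) \<and> inverts_mat P Q \<and> inverts_mat Q P \<and>
        0 < k \<and> 0 < l \<and>
        B1 \<in> carrier_mat k k \<and> B2 \<in> carrier_mat l l \<and> C \<in> carrier_mat l k \<and>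
        Q * B * P = four_block_mat B1 (0\<^sub>m k l) C B2)"

text \<open>By convention the 1 by 1 zero matrix does not count as irreducible.\<close>

definition irreducible_mat :: "real mat \<Rightarrow> bool" where
  "irreducible_mat B \<longleftrightarrow> \<not> reducible_mat B \<and> B \<noteq> 0\<^sub>m 1 1"

definition index_pairs :: "nat \<Rightarrow> (nat \<times> nat) list" where
  "index_pairs n = [(i, j). i \<leftarrow> [0..<n], j \<leftarrow> [Suc i..<n]]"

definition pair_number :: "nat \<Rightarrow> nat \<times> nat \<Rightarrow> nat" where
  "pair_number n p = (THE \<alpha>. \<alpha> < n choose 2 \<and> index_pairs n ! \<alpha> = p)"

definition second_compound :: "real mat \<Rightarrow> real mat" where
  "second_compound A =
     (let n = dim_row A in
      mat (n choose 2) (n choose 2)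
        (\<lambda>(\<alpha>, \<beta>).
           let (i, j) = index_pairs n ! \<alpha>; (k, l) = index_pairs n ! \<beta>
           in A $$ (i, k) * A $$ (j, l) - A $$ (i, l) * A $$ (j, k)))"

definition W_hat :: "nat \<Rightarrow> nat set \<Rightarrow> nat set \<Rightarrow> (nat \<times> nat) set" where
  "W_hat n J Jt =
     {(i, j). i < n \<and> j < n \<and>
        (i = j
         \<or> i < j \<and> (i \<in> J) = (j \<in> J) \<and> pair_number n (i, j) \<in> Jt
         \<or> i < j \<and> (i \<in> J) \<noteq> (j \<in> J) \<and> pair_number n (i, j) \<notin> Jt
         \<or> i > j \<and> (i \<in> J) = (j \<in> J) \<and> pair_number n (j, i) \<notin> Jt
         \<or> i > j \<and> (i \<in> J) \<noteq> (j \<in> J) \<and> pair_number n (j, i) \<in> Jt)}"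

definition eigvals :: "real mat \<Rightarrow> complex multiset" where
  "eigvals B = proots (char_poly (map_mat complex_of_real B))"

abbreviation simple_eigenvalue :: "real mat \<Rightarrow> complex \<Rightarrow> bool" where
  "simple_eigenvalue B z \<equiv> count (eigvals B) z = 1"

definition rho :: "real mat \<Rightarrow> real" where
  "rho B = spectral_radius (map_mat complex_of_real B)"

definition h_index :: "real mat \<Rightarrow> nat" where
  "h_index B = size {# z \<in># eigvals B. cmod z = rho B #}"


lemma set_index_pairs: "set (index_pairs n) = {(i, j). i < j \<and> j < n}"
  by (fastforce simp: index_pairs_def image_iff)

lemma sorted_index_pairs:
  "sorted_wrt (\<lambda>(i, j) (k, l). i < k \<or> i = k \<and> j < l) (index_pairs n)"
proof -
  have "sorted_wrt (\<lambda>(i, j) (k, l). i < k \<or> i = k \<and> j < l)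
          (concat (map (\<lambda>i. map (Pair i) [Suc i..<n]) xs))"
    if "sorted_wrt (<) xs" for xs :: "nat list"
    using that
    by (induction xs) (auto simp: sorted_wrt_append sorted_wrt_map strict_sorted_iff)
  from this[of "[0..<n]"] show ?thesis
    by (simp add: index_pairs_def)
qed

lemma distinct_index_pairs: "distinct (index_pairs n)"
proof -
  have "distinct xs" if "sorted_wrt (\<lambda>(i, j) (k, l). i < k \<or> i = k \<and> j < l) xs"
    for xs :: "(nat \<times> nat) list"
    using that by (induction xs) auto
  thus ?thesis
    using sorted_index_pairs by blast
qed

lemma length_index_pairs: "length (index_pairs n) = n choose 2"
proof -
  have "length (index_pairs n) = (\<Sum>i<n. n - Suc i)"
    by (simp add: index_pairs_def length_concat o_def atLeast0LessThan
        sum_list_distinct_conv_sum_set)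
  also have "\<dots> = (\<Sum>i<n. i)"
    by (rule sum.nat_diff_reindex)
  also have "\<dots> = n choose 2"
    by (induction n) (auto simp: numeral_2_eq_2)
  finally show ?thesis .
qed

lemma pair_number:
  assumes "i < j" "j < n"
  shows "pair_number n (i, j) < n choose 2" "index_pairs n ! pair_number n (i, j) = (i, j)"
proof -
  have "\<exists>!\<alpha>. \<alpha> < n choose 2 \<and> index_pairs n ! \<alpha> = (i, j)"
    using assms distinct_Ex1[OF distinct_index_pairs, of "(i, j)" n]
    by (simp add: set_index_pairs length_index_pairs)
  from theI'[OF this]
  show "pair_number n (i, j) < n choose 2" "index_pairs n ! pair_number n (i, j) = (i, j)"
    by (auto simp: pair_number_def)
qed

lemma pair_number_nth: "\<alpha> < n choose 2 \<Longrightarrow> pair_number n (index_pairs n ! \<alpha>) = \<alpha>"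
  unfolding pair_number_def
  by (rule the_equality)
    (auto simp: nth_eq_iff_index_eq[OF distinct_index_pairs] length_index_pairs)

lemma second_compound_carrier:
  "A \<in> carrier_mat n n \<Longrightarrow> second_compound A \<in> carrier_mat (n choose 2) (n choose 2)"
  by (auto simp: second_compound_def Let_def)

lemma size_eigvals: "B \<in> carrier_mat m m \<Longrightarrow> size (eigvals B) = m"
  by (simp add: eigvals_def size_proots_complex degree_monic_char_poly)

lemma set_eigvals:
  assumes "B \<in> carrier_mat m m"
  shows "set_mset (eigvals B) = spectrum (map_mat complex_of_real B)"
proof -
  have B: "map_mat complex_of_real B \<in> carrier_mat m m"
    using assms by simp
  have "char_poly (map_mat complex_of_real B) \<noteq> 0"
    using degree_monic_char_poly[OF B] by auto
  thus ?thesis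
    by (simp add: eigvals_def spectrum_root_char_poly[OF B])
qed

end

theory Submission
  imports Defs
begin

text \<open>
  Conjugating \<open>A\<close> and its second compound with diagonal sign matrices makes both nonnegative and
  irreducible, so by Perron--Frobenius the eigenvalues of modulus \<open>\<rho>\<close> are simple and are the roots
  of \<open>z\<^sup>h = \<rho>\<^sup>h\<close>, for each of the two matrices. The eigenvalues of the compound are the products of two
  eigenvalues of \<open>A\<close>. If \<open>h(A) \<ge> 4\<close>, then two of the peripheral products coincide, against
  simplicity; if \<open>h(A) = 2\<close>, the only peripheral product is \<open>-\<rho>\<^sup>2\<close>, against Perron--Frobenius for
  the compound. So \<open>h(A)\<close> is \<open>1\<close> or \<open>3\<close>.

  If \<open>h(A) = 1\<close>, the peripheral eigenvalues of the compound are \<open>\<rho>(A) z\<close> with \<open>z\<close> on the second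
  circle of the spectrum of \<open>A\<close>, and \<open>W_hat\<close> is the linear order given by the quotients of the
  coordinates of the eigenvectors for \<open>\<lambda>\<^sub>2\<close> and \<open>\<lambda>\<^sub>1\<close>. If \<open>h(A) = 3\<close>, the nonnegative conjugate
  of \<open>A\<close> has zero diagonal, and minors through the last element contradict linearity of \<open>W_hat\<close>.
\<close>

section \<open>Eigenvalues and triangularization\<close>

text \<open>The obstacle is that the two sign changes are chosen independently. Conjugating
  \<open>A\<close> by the signs of \<open>J\<close> multiplies each minor by the signs of its rows
  and columns, and the resulting compound need not be nonnegative: it becomes so only after a
  further conjugation whose signs depend on both \<open>J\<close> and \<open>Jt\<close>. This
  discrepancy is a sign attached to each pair of indices, and \<open>W_hat\<close> records where it
  is -1. Transitivity asks whether these signs come from comparing numbers; for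
  \<open>h(A) = 1\<close> such numbers exist. The value of \<open>h(A)\<close> is found from the
  eigenvalues alone. Three survives where two and four fail because the products of two distinct
  cube roots of unity are again the three cube roots. For \<open>h(A) = 1\<close> the second
  eigenvalue is real and positive because the Perron root of the compound is \<open>rho A\<close>
  times it. All of the Perron--Frobenius theory rests on one fact: a nonzero nonnegative
  \<open>y\<close> with \<open>B y \<ge> rho(B) y\<close> is a positive eigenvector. The moduli of
  an eigenvector for an eigenvalue of modulus \<open>rho(B)\<close> form such a
  \<open>y\<close>.\<close>

definition mat_act :: "real mat \<Rightarrow> (nat \<Rightarrow> 'a::real_vector) \<Rightarrow> nat \<Rightarrow> 'a" where
  "mat_act B x i = (\<Sum>j<dim_row B. B $$ (i, j) *\<^sub>R x j)"

text \<open>Vectors are functions on all of \<open>nat\<close>, of which only the values below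
  \<open>dim_row B\<close> count. This spares dimension conditions and lets one
  \<open>mat_act\<close> serve real and complex vectors.\<close>

definition is_eigenfun :: "real mat \<Rightarrow> complex \<Rightarrow> (nat \<Rightarrow> complex) \<Rightarrow> bool" where
  "is_eigenfun B z x \<longleftrightarrow>
     (\<exists>i<dim_row B. x i \<noteq> 0) \<and> (\<forall>i<dim_row B. mat_act B x i = z * x i)"

lemma mat_act_cong: "(\<And>j. j < dim_row B \<Longrightarrow> x j = y j) \<Longrightarrow> mat_act B x i = mat_act B y i"
  by (simp add: mat_act_def)

lemma mat_act_add: "mat_act B (\<lambda>j. x j + y j) i = mat_act B x i + mat_act B y i"
  by (simp add: mat_act_def scaleR_add_right sum.distrib)

lemma mat_act_diff: "mat_act B (\<lambda>j. x j - y j) i = mat_act B x i - mat_act B y i"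
  by (simp add: mat_act_def scaleR_diff_right sum_subtractf)

lemma mat_act_mult:
  "mat_act B (\<lambda>j. c * x j) i = (c :: 'a :: real_algebra) * mat_act B x i"
  by (simp add: mat_act_def sum_distrib_left)

lemma mat_act_of_real:
  "mat_act B (\<lambda>j. of_real (u j) :: 'a :: real_algebra_1) i = of_real (mat_act B u i)"
  by (simp add: mat_act_def scaleR_conv_of_real)

lemma mult_mat_vec_eq_mat_act:
  assumes "B \<in> carrier_mat m m" "v \<in> carrier_vec m" "i < m"
  shows "(map_mat complex_of_real B *\<^sub>v v) $ i = mat_act B (\<lambda>j. v $ j) i"
  using assms
  by (auto simp: mat_act_def scalar_prod_def scaleR_conv_of_real lessThan_atLeast0 intro!: sum.cong)

lemma eigenvector_iff_is_eigenfun: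
  assumes "B \<in> carrier_mat m m" "v \<in> carrier_vec m"
  shows "eigenvector (map_mat complex_of_real B) v z \<longleftrightarrow> is_eigenfun B z (\<lambda>i. v $ i)"
proof -
  have "v \<noteq> 0\<^sub>v m \<longleftrightarrow> (\<exists>i<m. v $ i \<noteq> 0)"
    using assms(2) by (auto simp: vec_eq_iff)
  moreover have "map_mat complex_of_real B *\<^sub>v v = z \<cdot>\<^sub>v v \<longleftrightarrow>
      (\<forall>i<m. mat_act B (\<lambda>j. v $ j) i = z * v $ i)"
    using assms by (auto simp: vec_eq_iff mult_mat_vec_eq_mat_act simp del: index_mult_mat_vec)
  ultimately show ?thesis
    using assms by (auto simp: eigenvector_def is_eigenfun_def)
qed

lemma in_eigvals_iff:
  assumes B: "B \<in> carrier_mat m m"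
  shows "z \<in># eigvals B \<longleftrightarrow> (\<exists>x. is_eigenfun B z x)"
proof
  assume "z \<in># eigvals B"
  then obtain v where "eigenvector (map_mat complex_of_real B) v z"
    using set_eigvals[OF B] by (auto simp: spectrum_def eigenvalue_def)
  moreover from this have "v \<in> carrier_vec m"
    using B by (simp add: eigenvector_def)
  ultimately show "\<exists>x. is_eigenfun B z x"
    using eigenvector_iff_is_eigenfun[OF B] by blast
next
  assume "\<exists>x. is_eigenfun B z x"
  then obtain x where x: "is_eigenfun B z x" ..
  have "is_eigenfun B z (\<lambda>i. vec m x $ i)"
    using x B by (auto simp: is_eigenfun_def intro: mat_act_cong[THEN trans])
  hence "eigenvector (map_mat complex_of_real B) (vec m x) z"
    using eigenvector_iff_is_eigenfun[OF B, of "vec m x" z] by simp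
  thus "z \<in># eigvals B"
    using set_eigvals[OF B] by (auto simp: spectrum_def eigenvalue_def)
qed

lemma cmod_eigvals_le_rho:
  assumes B: "B \<in> carrier_mat m m" and z: "z \<in># eigvals B"
  shows "cmod z \<le> rho B"
proof -
  have "m > 0"
    using size_eigvals[OF B] z by (cases m) auto
  thus ?thesis
    using spectral_radius_mem_max(2)[of "map_mat complex_of_real B" m "cmod z"] z B
    by (auto simp: rho_def set_eigvals)
qed

lemma ex_eigval_rho:
  assumes B: "B \<in> carrier_mat m m" and "m > 0"
  shows "\<exists>z\<in>#eigvals B. cmod z = rho B"
  using spectral_radius_mem_max(1)[of "map_mat complex_of_real B" m] assms
  by (auto simp: rho_def set_eigvals)

lemma proots_linear_factors:
  "proots (\<Prod>a\<leftarrow>as. [:- a, 1:]) = mset (as :: 'a :: field list)"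
proof (induction as)
  case (Cons a as)
  have "(\<Prod>a\<leftarrow>as. [:- a, 1:]) \<noteq> 0"
    by (auto simp: prod_list_zero_iff)
  with Cons show ?case
    by (simp add: proots_mult del: mult_pCons_left mult_pCons_right)
qed auto

lemma char_poly_eq_prod_eigvals:
  assumes B: "B \<in> carrier_mat m m" and es: "mset es = eigvals B"
  shows "char_poly (map_mat complex_of_real B) = (\<Prod>a\<leftarrow>es. [:- a, 1:])"
proof -
  obtain as where as: "char_poly (map_mat complex_of_real B) = (\<Prod>a\<leftarrow>as. [:- a, 1:])"
    using char_poly_factorized[of "map_mat complex_of_real B" m] B by auto
  with es have "mset as = mset es"
    by (simp add: eigvals_def proots_linear_factors)
  hence "mset (map (\<lambda>a. [:- a, 1:]) as) = mset (map (\<lambda>a. [:- a, 1:]) es)"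
    by simp
  thus ?thesis
    unfolding as by (metis prod_mset_prod_list)
qed

lemma eigvals_of_factorization:
  assumes "char_poly (map_mat complex_of_real B) = (\<Prod>a\<leftarrow>es. [:- a, 1:])"
  shows "eigvals B = mset es"
  by (simp add: eigvals_def assms proots_linear_factors)

text \<open>The order of the diagonal is free, so the simplicity proof can put a repeated eigenvalue
  in the first two places.\<close>

lemma triangularization:
  assumes B: "B \<in> carrier_mat m m" and es: "mset es = eigvals B"
  obtains T P Q where "similar_mat_wit (map_mat complex_of_real B) T P Q"
    "upper_triangular T" "diag_mat T = es"
proof -
  obtain T P Q where "schur_decomposition (map_mat complex_of_real B) es = (T, P, Q)"
    by (cases "schur_decomposition (map_mat complex_of_real B) es")
  from schur_decomposition[OF _ char_poly_eq_prod_eigvals[OF B es] this, of m] that B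
  show ?thesis by auto
qed

lemma eigvals_transpose: "B \<in> carrier_mat m m \<Longrightarrow> eigvals (transpose_mat B) = eigvals B"
  using char_poly_transpose_mat[of "map_mat complex_of_real B" m]
  by (simp add: eigvals_def map_mat_transpose)

lemma rho_transpose: 
  assumes B: "B \<in> carrier_mat m m"
  shows "rho (transpose_mat B) = rho B"
  using set_eigvals[OF B] set_eigvals[of "transpose_mat B" m] B eigvals_transpose[OF B]
  by (simp add: rho_def spectral_radius_def)

section \<open>Perron--Frobenius theory\<close>

lemma Re_eq_cmod_imp: "Re w = cmod w \<Longrightarrow> w = of_real (cmod w)"
  using cmod_power2[of w] by (auto simp: complex_eq_iff)

lemma mat_act_mono:
  fixes x y :: "nat \<Rightarrow> real"
  assumes "\<And>j. j < dim_row B \<Longrightarrow> 0 \<le> B $$ (i, j)" "\<And>j. j < dim_row B \<Longrightarrow> x j \<le> y j"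
  shows "mat_act B x i \<le> mat_act B y i"
  unfolding mat_act_def using assms by (auto intro!: sum_mono mult_left_mono)

lemma mat_act_smult_mat:
  assumes "B \<in> carrier_mat m m" "i < m"
  shows "mat_act (c \<cdot>\<^sub>m B) x i = c *\<^sub>R mat_act B x i"
  using assms by (auto simp: mat_act_def scaleR_right.sum)

text \<open>\<open>connected\<close> is irreducibility without permutation matrices. It says nothing
  for \<open>n = 1\<close>, where \<open>nonzero\<close> carries the convention on the zero
  matrix.\<close>

locale nonneg_irreducible =
  fixes B :: "real mat" and n :: nat
  assumes carrier: "B \<in> carrier_mat n n"
    and nonneg: "\<And>i j. i < n \<Longrightarrow> j < n \<Longrightarrow> 0 \<le> B $$ (i, j)"
    and connected: "\<And>S. S \<subseteq> {..<n} \<Longrightarrow> S \<noteq> {} \<Longrightarrow> S \<noteq> {..<n} \<Longrightarrow>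
      \<exists>i\<in>S. \<exists>j\<in>{..<n} - S. B $$ (i, j) \<noteq> 0"
    and nonzero: "\<exists>i<n. \<exists>j<n. B $$ (i, j) \<noteq> 0"
begin

lemma dim [simp]: "dim_row B = n" "dim_col B = n"
  using carrier by auto

lemma n_pos: "n > 0"
  using nonzero by auto

lemma transpose: "nonneg_irreducible (transpose_mat B) n"
proof
  fix S assume S: "S \<subseteq> {..<n}" "S \<noteq> {}" "S \<noteq> {..<n}"
  hence "\<exists>i\<in>{..<n} - S. \<exists>j\<in>{..<n} - ({..<n} - S). B $$ (i, j) \<noteq> 0"
    by (intro connected) auto
  then obtain i j where "i < n" "i \<notin> S" "j < n" "j \<in> S" "B $$ (i, j) \<noteq> 0"
    by auto
  thus "\<exists>i\<in>S. \<exists>j\<in>{..<n} - S. transpose_mat B $$ (i, j) \<noteq> 0"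
    by (intro bexI[of _ j] bexI[of _ i]) auto
next
  show "\<exists>i<n. \<exists>j<n. transpose_mat B $$ (i, j) \<noteq> 0"
    using nonzero carrier by (metis index_transpose_mat(1) carrier_matD)
qed (use carrier nonneg in auto)

lemma rho_nonneg: "0 \<le> rho B"
  using ex_eigval_rho[OF carrier n_pos] by (metis norm_ge_zero)

lemma mat_act_nonneg:
  "(\<And>j. j < n \<Longrightarrow> 0 \<le> y j) \<Longrightarrow> i < n \<Longrightarrow> 0 \<le> mat_act B y i" for y :: "nat \<Rightarrow> real"
  unfolding mat_act_def using nonneg by (auto intro!: sum_nonneg mult_nonneg_nonneg)

section \<open>Subinvariant vectors and the Perron vector\<close>

text \<open>This is \<open>I + B\<close>. The identity summand keeps positive coordinates positive,
  which \<open>B\<close> alone need not do.\<close>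

definition step :: "(nat \<Rightarrow> real) \<Rightarrow> nat \<Rightarrow> real" where
  "step y i = y i + mat_act B y i"

lemma step_pow_ge:
  assumes "\<And>i. i < n \<Longrightarrow> 0 \<le> y i" and "i < n"
  shows "y i \<le> (step ^^ k) y i"
proof -
  have "\<forall>i<n. y i \<le> (step ^^ k) y i"
  proof (induction k)
    case (Suc k)
    show ?case
    proof (intro allI impI)
      fix i assume i: "i < n"
      have "0 \<le> mat_act B ((step ^^ k) y) i"
        using Suc assms(1) i by (intro mat_act_nonneg) (auto intro: order_trans)
      thus "y i \<le> (step ^^ Suc k) y i"
        using Suc i by (simp add: step_def[of "(step ^^ k) y"] add_increasing2)
    qed
  qed auto
  thus ?thesis using assms(2) by blast
qed

text \<open>By \<open>connected\<close>, some zero coordinate is linked to a positive one and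
  becomes positive in the next step. Hence the induction on the number of zeros.\<close>

lemma step_pow_pos:
  assumes "\<And>i. i < n \<Longrightarrow> 0 \<le> y i" and "\<exists>i<n. 0 < y i"
  shows "\<exists>k. \<forall>i<n. 0 < (step ^^ k) y i"
  using assms
proof (induction "card {i\<in>{..<n}. y i = 0}" arbitrary: y rule: less_induct)
  case less
  define S where "S = {i\<in>{..<n}. y i = 0}"
  show ?case
  proof (cases "S = {}")
    case True
    thus ?thesis
      using less.prems(1) by (intro exI[of _ 0]) (fastforce simp: S_def order_less_le)
  next
    case False
    moreover obtain l where "l < n" "0 < y l"
      using less.prems(2) by blast
    hence "l \<in> {..<n}" "l \<notin> S" by (auto simp: S_def)
    moreover have "S \<subseteq> {..<n}" by (auto simp: S_def)
    ultimately obtain i j where ij: "i \<in> S" "j < n" "j \<notin> S" "B $$ (i, j) \<noteq> 0"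
      using connected[of S] by blast
    hence i: "i < n" and yj: "0 < y j"
      using less.prems(1)[of j] by (auto simp: S_def)
    have ge: "y k \<le> step y k" if "k < n" for k
      using step_pow_ge[of y k 1] less.prems(1) that by simp
    have "0 < B $$ (i, j) * y j"
      using ij i yj nonneg[of i j] by simp
    also have "\<dots> \<le> mat_act B y i"
      unfolding mat_act_def using ij i nonneg less.prems(1)
      by (auto intro!: member_le_sum[of j "{..<n}" "\<lambda>j. B $$ (i, j) * y j"])
    also have "\<dots> \<le> step y i"
      using less.prems(1)[OF i] by (simp add: step_def)
    finally have "i \<notin> {i\<in>{..<n}. step y i = 0}" by simp
    hence "{i\<in>{..<n}. step y i = 0} \<subset> S"
      using ij(1) ge less.prems(1) by (fastforce simp: S_def)
    hence "card {i\<in>{..<n}. step y i = 0} < card S"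
      by (intro psubset_card_mono) (auto simp: S_def)
    moreover have "\<exists>i<n. 0 < step y i"
      using ge less.prems(2) by (meson less_le_trans)
    moreover have "0 \<le> step y i" if "i < n" for i
      using ge less.prems(1) that order_trans by blast
    ultimately obtain k where "\<forall>i<n. 0 < (step ^^ k) (step y) i"
      using less.hyps[of "step y"] unfolding S_def by blast
    thus ?thesis
      by (intro exI[of _ "Suc k"]) (simp add: funpow_swap1)
  qed
qed

text \<open>\<open>B - c\<close> commutes with \<open>I + B\<close>, so the defect
  \<open>B y - c y\<close> is made positive by the same powers that act on \<open>y\<close>.\<close>

lemma mat_act_step_pow:
  "mat_act B ((step ^^ k) y) i - c * (step ^^ k) y i = (step ^^ k) (\<lambda>i. mat_act B y i - c * y i) i"
proof (induction k arbitrary: i)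
  case (Suc k)
  have eq: "(\<lambda>i. mat_act B ((step ^^ k) y) i - c * (step ^^ k) y i)
      = (step ^^ k) (\<lambda>i. mat_act B y i - c * y i)"
    using Suc by auto
  show ?case
    unfolding funpow.simps o_apply eq[symmetric]
    by (simp add: step_def[abs_def] mat_act_add mat_act_diff mat_act_mult algebra_simps)
qed auto

text \<open>If \<open>B y\<close> dominated \<open>s y\<close> for some \<open>s\<close> above the spectral radius, the powers of \<open>B\<close>
  divided by a number strictly between the two would be bounded, but would make \<open>y\<close> grow
  geometrically.\<close>

lemma no_growth_above_rho:
  assumes y: "\<And>i. i < n \<Longrightarrow> 0 \<le> y i" "i\<^sub>0 < n" "0 < y i\<^sub>0"
    and s: "rho B < s" and grow: "\<And>i. i < n \<Longrightarrow> s * y i \<le> mat_act B y i"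
  shows False
proof -
  \<comment> \<open>The midpoint lies above \<open>rho B\<close>, so that the powers of
    \<open>B / t\<close> stay bounded, and below \<open>s\<close>, so that \<open>y\<close> grows by
    the factor \<open>q = s / t > 1\<close>.\<close>
  define t where "t = (rho B + s) / 2"
  have t: "rho B < t" "t < s" "0 < t"
    using s rho_nonneg by (auto simp: t_def)
  define q where "q = s / t"
  have q: "1 < q" using t by (simp add: q_def)
  define R where "R = (1 / t) \<cdot>\<^sub>m B"
  have R: "R \<in> carrier_mat n n"
    using carrier by (simp add: R_def)
  have actR: "mat_act R x i = mat_act B x i /\<^sub>R t" if "i < n" for x :: "nat \<Rightarrow> 'a::real_vector" and i
    using mat_act_smult_mat[OF carrier that, of "1 / t" x] by (simp add: R_def divide_inverse)
  define C where "C = map_mat complex_of_real R"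
  have C: "C \<in> carrier_mat n n" using R by (simp add: C_def)
  have "rho R < 1"
  proof -
    obtain z where z: "z \<in># eigvals R" "cmod z = rho R"
      using ex_eigval_rho[OF R n_pos] by blast
    then obtain x where x: "is_eigenfun R z x"
      using in_eigvals_iff[OF R] by blast
    hence "is_eigenfun B (of_real t * z) x"
      using R t by (auto simp: is_eigenfun_def actR scaleR_conv_of_real divide_simps)
    hence "of_real t * z \<in># eigvals B"
      using in_eigvals_iff[OF carrier] by blast
    hence "cmod (of_real t * z) \<le> rho B"
      by (rule cmod_eigvals_le_rho[OF carrier])
    hence "t * rho R \<le> rho B"
      using z t by (simp add: norm_mult)
    also have "\<dots> < t * 1" using t by simp
    finally show ?thesis using t by simp
  qed
  then obtain c where c: "norm_bound (C ^\<^sub>m k) c" for k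
    using spectral_radius_jnf_norm_bound_less_1_upper_triangular[OF C]
    by (auto simp: rho_def C_def)
  \<comment> \<open>Generalized over \<open>w\<close> and \<open>a\<close> because the power of
    \<open>C\<close> is peeled off next to the vector: this replaces \<open>w\<close> by its image
    and \<open>a\<close> by \<open>a * q\<close>. \<open>W\<close> names the real coordinates of a
    complex vector.\<close>
  have growth: "\<exists>W. \<forall>i<n. (C ^\<^sub>m k *\<^sub>v vec n (\<lambda>i. of_real (w i))) $ i = complex_of_real (W i) \<and>
      a * q ^ k * y i \<le> W i"
    if "0 \<le> a" "\<And>i. i < n \<Longrightarrow> a * y i \<le> w i" for k a w
    using that
  proof (induction k arbitrary: a w)
    case 0
    thus ?case using C by (intro exI[of _ w]) auto
  next
    case (Suc k)
    define w' where "w' = mat_act R w"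
    have "C ^\<^sub>m Suc k *\<^sub>v vec n (\<lambda>i. of_real (w i)) =
        C ^\<^sub>m k *\<^sub>v (C *\<^sub>v vec n (\<lambda>i. of_real (w i)))"
      using C by (simp add: assoc_mult_mat_vec[of _ n n _ n])
    also have "C *\<^sub>v vec n (\<lambda>i. of_real (w i)) = vec n (\<lambda>i. of_real (w' i))"
    proof (rule eq_vecI)
      fix i assume "i < dim_vec (vec n (\<lambda>i. complex_of_real (w' i)))"
      hence i: "i < n" by simp
      have "(C *\<^sub>v vec n (\<lambda>i. of_real (w i))) $ i
          = mat_act R (\<lambda>j. vec n (\<lambda>i. complex_of_real (w i)) $ j) i"
        unfolding C_def by (rule mult_mat_vec_eq_mat_act[OF R _ i]) auto
      also have "\<dots> = mat_act R (\<lambda>j. of_real (w j)) i"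
        using R by (intro mat_act_cong) auto
      also have "\<dots> = of_real (w' i)"
        unfolding w'_def by (rule mat_act_of_real)
      finally show "(C *\<^sub>v vec n (\<lambda>i. of_real (w i))) $ i = vec n (\<lambda>i. of_real (w' i)) $ i"
        using i by simp
    qed (use C in auto)
    finally have eq: "C ^\<^sub>m Suc k *\<^sub>v vec n (\<lambda>i. of_real (w i)) =
        C ^\<^sub>m k *\<^sub>v vec n (\<lambda>i. of_real (w' i))" .
    have "a * q * y i \<le> w' i" if i: "i < n" for i
    proof -
      have "a * (s * y i) \<le> a * mat_act B y i"
        by (intro mult_left_mono grow i Suc.prems)
      also have "\<dots> = mat_act B (\<lambda>j. a * y j) i"
        by (simp add: mat_act_mult)
      also have "\<dots> \<le> mat_act B w i"
        using i Suc.prems nonneg by (intro mat_act_mono) auto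
      finally have "a * (s * y i) / t \<le> mat_act B w i / t"
        using t by (intro divide_right_mono) auto
      thus ?thesis
        using i by (simp add: w'_def actR q_def divide_inverse mult_ac)
    qed
    from Suc.IH[of "a * q" w', OF _ this] Suc.prems(1) q show ?case
      unfolding eq by (simp add: mult_ac)
  qed
  define Y where "Y = (\<Sum>j<n. y j)"
  \<comment> \<open>The entries of the power of \<open>C\<close> are bounded by \<open>c\<close>, so
    no coordinate of the image of \<open>y\<close> exceeds \<open>c * Y\<close> in modulus. This
    \<open>k\<close> lifts the lower bound \<open>q ^ k * y i\<^sub>0\<close> above that.\<close>
  obtain k where k: "c * Y / y i\<^sub>0 < q ^ k"
    using real_arch_pow[OF q] by blast
  obtain W where W: "\<And>i. i < n \<Longrightarrow>
      (C ^\<^sub>m k *\<^sub>v vec n (\<lambda>i. of_real (y i))) $ i = complex_of_real (W i)"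
    "\<And>i. i < n \<Longrightarrow> 1 * q ^ k * y i \<le> W i"
    using growth[of 1 y k] by auto
  have Ck: "C ^\<^sub>m k \<in> carrier_mat n n" using C by simp
  have entry: "cmod ((C ^\<^sub>m k) $$ (i\<^sub>0, j)) \<le> c" if "j < n" for j
    using c[of k] carrier_matD[OF Ck] y(2) that unfolding norm_bound_def by metis
  have "q ^ k * y i\<^sub>0 \<le> W i\<^sub>0" using W(2)[OF y(2)] by simp
  also have "\<dots> \<le> cmod (complex_of_real (W i\<^sub>0))" by simp
  also have "complex_of_real (W i\<^sub>0) = (\<Sum>j<n. (C ^\<^sub>m k) $$ (i\<^sub>0, j) * of_real (y j))"
    using carrier_matD[OF Ck] y(2) by (simp add: W(1)[symmetric] scalar_prod_def lessThan_atLeast0)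
  also have "cmod \<dots> \<le> (\<Sum>j<n. c * y j)"
    using entry y(1) by (intro sum_norm_le) (auto simp: norm_mult intro!: mult_right_mono)
  also have "\<dots> = c * Y" by (simp add: Y_def sum_distrib_left)
  finally show False using k y(3) by (simp add: field_simps)
qed

text \<open>If the inequality were strict somewhere, a power of \<open>I + B\<close> would make it
  strict everywhere, leaving room for a factor \<open>rho B + e\<close>, which
  \<open>no_growth_above_rho\<close> forbids. Positivity follows because on an eigenvector these
  powers only multiply by \<open>(1 + rho B) ^ k\<close>.\<close>

lemma subinvariant_imp_eigenfun:
  assumes y: "\<And>i. i < n \<Longrightarrow> 0 \<le> y i" "\<exists>i<n. 0 < y i"
    and sub: "\<And>i. i < n \<Longrightarrow> rho B * y i \<le> mat_act B y i"
  shows "\<forall>i<n. mat_act B y i = rho B * y i" "\<forall>i<n. 0 < y i"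
proof -
  define z where "z = (\<lambda>i. mat_act B y i - rho B * y i)"
  have z: "0 \<le> z i" if "i < n" for i
    using sub[OF that] by (simp add: z_def)
  show eq: "\<forall>i<n. mat_act B y i = rho B * y i"
  proof (rule ccontr)
    assume "\<not> (\<forall>i<n. mat_act B y i = rho B * y i)"
    hence "\<exists>i<n. 0 < z i" using z by (force simp: z_def order_less_le)
    then obtain k where k: "\<forall>i<n. 0 < (step ^^ k) z i"
      using step_pow_pos[of z] z by blast
    define y' where "y' = (step ^^ k) y"
    have y': "y i \<le> y' i" if "i < n" for i
      using step_pow_ge[of y, OF y(1) that] by (simp add: y'_def)
    hence y'0: "0 \<le> y' i" if "i < n" for i
      using y(1) that order_trans by blast
    have z': "mat_act B y' i - rho B * y' i = (step ^^ k) z i" for i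
      unfolding y'_def z_def by (rule mat_act_step_pow)
    \<comment> \<open>The summand 1 keeps the denominator positive where \<open>y'\<close> vanishes;
      only \<open>e * y' \<le> e * (1 + y')\<close> is needed afterwards.\<close>
    define e where "e = Min ((\<lambda>i. (step ^^ k) z i / (1 + y' i)) ` {..<n})"
    have "0 < e"
      unfolding e_def using k y'0 n_pos by (subst Min_gr_iff) (auto simp: add_pos_nonneg)
    have "e * y' i \<le> (step ^^ k) z i" if "i < n" for i
    proof -
      have "e * y' i \<le> e * (1 + y' i)" using \<open>0 < e\<close> by simp
      also have "e \<le> (step ^^ k) z i / (1 + y' i)"
        unfolding e_def using that by auto
      hence "e * (1 + y' i) \<le> (step ^^ k) z i"
        using y'0[OF that] by (simp add: field_simps)
      finally show ?thesis .
    qed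
    hence "(rho B + e) * y' i \<le> mat_act B y' i" if "i < n" for i
      using z'[of i] that by (force simp: algebra_simps)
    moreover obtain i where "i < n" "0 < y' i"
      using y(2) y' by (meson less_le_trans)
    ultimately show False
      using no_growth_above_rho[of y' i "rho B + e"] y'0 \<open>0 < e\<close> by auto
  qed
  obtain k where k: "\<forall>i<n. 0 < (step ^^ k) y i"
    using step_pow_pos[of y] y by blast
  have "\<forall>i<n. (step ^^ k) y i = (1 + rho B) ^ k * y i" for k
  proof (induction k)
    case (Suc k)
    have "mat_act B ((step ^^ k) y) i = (1 + rho B) ^ k * mat_act B y i" for i
      using Suc by (subst mat_act_mult[symmetric]) (auto intro!: mat_act_cong)
    thus ?case using Suc eq by (simp add: step_def[of "(step ^^ k) y"] algebra_simps)
  qed auto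
  hence "\<forall>i<n. 0 < (1 + rho B) ^ k * y i"
    using k by auto
  thus "\<forall>i<n. 0 < y i"
    using rho_nonneg by (auto simp: zero_less_mult_iff)
qed

text \<open>The triangle inequality makes the vector of moduli subinvariant.\<close>

lemma cmod_peripheral_eigenfun:
  assumes x: "is_eigenfun B z x" and z: "cmod z = rho B"
  shows "\<forall>i<n. mat_act B (\<lambda>i. cmod (x i)) i = rho B * cmod (x i)" "\<forall>i<n. x i \<noteq> 0"
proof -
  have sub: "rho B * cmod (x i) \<le> mat_act B (\<lambda>i. cmod (x i)) i" if "i < n" for i
  proof -
    have "rho B * cmod (x i) = cmod (mat_act B x i)"
      using x z that by (simp add: is_eigenfun_def norm_mult)
    also have "\<dots> \<le> (\<Sum>j<n. cmod (B $$ (i, j) *\<^sub>R x j))"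
      unfolding mat_act_def dim by (rule norm_sum)
    also have "\<dots> = mat_act B (\<lambda>i. cmod (x i)) i"
      using nonneg[OF that] by (simp add: mat_act_def)
    finally show ?thesis .
  qed
  have "\<exists>i<n. 0 < cmod (x i)"
    using x by (simp add: is_eigenfun_def)
  note eq = subinvariant_imp_eigenfun[of "\<lambda>i. cmod (x i)", OF _ this sub]
  show "\<forall>i<n. mat_act B (\<lambda>i. cmod (x i)) i = rho B * cmod (x i)"
    using eq(1) by simp
  show "\<forall>i<n. x i \<noteq> 0"
    using eq(2) by simp
qed

text \<open>No limit process is involved: some eigenvalue attains the spectral radius, and the
  moduli of its eigenvector already form the vector sought.\<close>

lemma perron_vector:
  obtains u where "\<And>i. i < n \<Longrightarrow> 0 < u i" "\<And>i. i < n \<Longrightarrow> mat_act B u i = rho B * u i"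
proof -
  obtain z x where "is_eigenfun B z x" "cmod z = rho B"
    using ex_eigval_rho[OF carrier n_pos] in_eigvals_iff[OF carrier] by blast
  from cmod_peripheral_eigenfun[OF this] that[of "\<lambda>i. cmod (x i)"] show ?thesis
    by simp
qed

lemma rho_pos: "0 < rho B"
proof -
  obtain u where u: "\<And>i. i < n \<Longrightarrow> 0 < u i" "\<And>i. i < n \<Longrightarrow> mat_act B u i = rho B * u i"
    using perron_vector by blast
  obtain i j where ij: "i < n" "j < n" "B $$ (i, j) \<noteq> 0"
    using nonzero by blast
  hence "0 < B $$ (i, j) * u j"
    using u(1) nonneg[of i j] by simp
  also have "\<dots> \<le> mat_act B u i"
    unfolding mat_act_def using ij nonneg u(1)
    by (auto intro!: member_le_sum[of j "{..<n}" "\<lambda>j. B $$ (i, j) * u j"] mult_nonneg_nonneg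
        simp: less_imp_le)
  also have "\<dots> = rho B * u i" using u(2) ij by simp
  finally show ?thesis
    using u(1)[OF ij(1)] by (simp add: zero_less_mult_iff)
qed

lemma rho_in_eigvals: "of_real (rho B) \<in># eigvals B"
proof -
  obtain u where u: "\<And>i. i < n \<Longrightarrow> 0 < u i" "\<And>i. i < n \<Longrightarrow> mat_act B u i = rho B * u i"
    using perron_vector by blast
  have "is_eigenfun B (of_real (rho B)) (\<lambda>i. of_real (u i))"
    using u n_pos by (force simp: is_eigenfun_def mat_act_of_real)
  thus ?thesis
    using in_eigvals_iff[OF carrier] by blast
qed

text \<open>This is the equality case of the triangle inequality in \<open>\<bar>B x\<bar> \<le> B \<bar>x\<bar>\<close>.\<close>

lemma peripheral_phase:
  fixes z :: complex and x :: "nat \<Rightarrow> complex"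
  assumes x: "is_eigenfun B z x" and z: "cmod z = rho B"
    and ij: "i < n" "j < n" "B $$ (i, j) \<noteq> 0"
  shows "rho B * cmod (x i) * x j = cmod (x j) * z * x i"
proof -
  have ne: "x i \<noteq> 0" and abs: "mat_act B (\<lambda>i. cmod (x i)) i = rho B * cmod (x i)"
    using cmod_peripheral_eigenfun[OF x z] ij by auto
  \<comment> \<open>Multiplying by this conjugate makes row \<open>i\<close> of \<open>B x\<close>
    real and nonnegative. The differences between modulus and real part of its terms, weighted by
    the entries of \<open>B\<close>, then sum to 0.\<close>
  define w where "w = cnj (z * x i)"
  have w: "cmod w = rho B * cmod (x i)"
    using z by (simp add: w_def norm_mult)
  have "(\<Sum>k<n. B $$ (i, k) * (cmod (w * x k) - Re (w * x k))) =
      cmod w * mat_act B (\<lambda>i. cmod (x i)) i - Re (w * mat_act B x i)"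
    by (simp add: mat_act_def sum_distrib_left sum_subtractf algebra_simps norm_mult
        scaleR_conv_of_real)
  also have "w * mat_act B x i = (cmod (z * x i))\<^sup>2"
    using x ij complex_norm_square[of "z * x i"]
    by (simp add: w_def is_eigenfun_def mult_ac)
  also have "cmod w * mat_act B (\<lambda>i. cmod (x i)) i - Re \<dots> = 0"
    unfolding Re_complex_of_real using w z by (simp add: abs norm_mult power2_eq_square)
  finally have sum0: "(\<Sum>k<n. B $$ (i, k) * (cmod (w * x k) - Re (w * x k))) = 0" .
  have "0 \<le> B $$ (i, k) * (cmod (w * x k) - Re (w * x k))" if "k \<in> {..<n}" for k
    using nonneg[OF ij(1)] that complex_Re_le_cmod[of "w * x k"]
    by (intro mult_nonneg_nonneg) (auto simp del: times_complex.sel)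
  with sum0 have "\<forall>k\<in>{..<n}. B $$ (i, k) * (cmod (w * x k) - Re (w * x k)) = 0"
    by (subst (asm) sum_nonneg_eq_0_iff) auto
  hence "Re (w * x j) = cmod (w * x j)" using ij by auto
  from Re_eq_cmod_imp[OF this] have "w * x j = of_real (rho B * cmod (x i) * cmod (x j))"
    by (simp add: norm_mult w)
  hence "(z * x i) * w * x j = (z * x i) * of_real (rho B * cmod (x i) * cmod (x j))"
    by (simp add: mult.assoc)
  also have "(z * x i) * w = of_real ((rho B * cmod (x i))\<^sup>2)"
    unfolding w_def by (simp only: complex_norm_square[symmetric]) (simp add: norm_mult z)
  finally have "of_real (rho B * cmod (x i)) * (rho B * cmod (x i) * x j) =
      of_real (rho B * cmod (x i)) * (cmod (x j) * z * x i)"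
    by (simp add: power2_eq_square mult_ac)
  thus ?thesis using ne rho_pos by simp
qed

text \<open>Division is possible because no coordinate of \<open>x\<close> vanishes. In this form
  the moduli disappear: along every nonzero entry the phase turns by the same factor.\<close>

lemma peripheral_phase':
  assumes x: "is_eigenfun B z x" and z: "cmod z = rho B"
    and ij: "i < n" "j < n" "B $$ (i, j) \<noteq> 0"
  shows "x j / cmod (x j) = z / rho B * (x i / cmod (x i))"
  using peripheral_phase[OF assms] cmod_peripheral_eigenfun(2)[OF x z] rho_pos ij
  by (simp add: field_simps)

text \<open>Subtracting the multiple that kills coordinate 0 leaves zero or an eigenvector with a
  vanishing coordinate, and the latter is impossible.\<close>

lemma peripheral_eigenfun_unique:
  assumes x: "is_eigenfun B z x" and y: "is_eigenfun B z y" and z: "cmod z = rho B"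
  shows "\<exists>c. \<forall>i<n. y i = c * x i"
proof (rule ccontr)
  assume contr: "\<not> ?thesis"
  define w where "w = (\<lambda>i. y i - y 0 / x 0 * x i)"
  have "\<not> (\<forall>i<n. y i = y 0 / x 0 * x i)"
    using contr by blast
  hence "\<exists>i<n. w i \<noteq> 0"
    by (auto simp: w_def)
  moreover have "mat_act B w i = z * w i" if "i < n" for i
    using x y that unfolding w_def
    by (simp add: is_eigenfun_def mat_act_diff mat_act_mult right_diff_distrib)
      (simp only: mat_act_mult times_divide_eq_left[symmetric], simp)
  ultimately have "is_eigenfun B z w"
    by (simp add: is_eigenfun_def)
  hence "w 0 \<noteq> 0"
    using cmod_peripheral_eigenfun(2) z n_pos by blast
  moreover have "x 0 \<noteq> 0"
    using cmod_peripheral_eigenfun(2)[OF x z] n_pos by blast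
  ultimately show False by (simp add: w_def)
qed

text \<open>The left eigenvector is the left Perron vector twisted by the phases of the right one.\<close>

lemma peripheral_left_eigenfun:
  assumes x: "is_eigenfun B z x" and z: "cmod z = rho B"
  obtains w where "(\<Sum>i<n. w i * x i) \<noteq> 0"
    "\<And>y. (\<Sum>i<n. w i * mat_act B y i) = z * (\<Sum>i<n. w i * y i)"
proof -
  interpret T: nonneg_irreducible "transpose_mat B" n by (rule transpose)
  obtain v where v: "\<And>i. i < n \<Longrightarrow> 0 < v i"
    "\<And>i. i < n \<Longrightarrow> mat_act (transpose_mat B) v i = rho B * v i"
    using T.perron_vector rho_transpose[OF carrier] by metis
  note ne = cmod_peripheral_eigenfun(2)[OF x z]
  define w where "w = (\<lambda>i. v i * cnj (x i / cmod (x i)))"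
  have "w i * x i = of_real (v i * cmod (x i))" for i
    using complex_norm_square[of "x i"]
    by (cases "x i = 0") (auto simp: w_def field_simps power2_eq_square)
  hence "(\<Sum>i<n. w i * x i) = of_real (\<Sum>i<n. v i * cmod (x i))"
    by simp
  moreover have "0 < (\<Sum>i<n. v i * cmod (x i))"
    using v(1) ne n_pos by (intro sum_pos) auto
  ultimately have "(\<Sum>i<n. w i * x i) \<noteq> 0" by (simp del: of_real_sum)
  moreover have "(\<Sum>i<n. w i * mat_act B y i) = z * (\<Sum>i<n. w i * y i)" for y
  proof -
    have col: "(\<Sum>i<n. w i * B $$ (i, j)) = z * w j" if j: "j < n" for j
    proof -
      \<comment> \<open>All nonzero terms of column \<open>j\<close> share one phase, which leaves
        the sum; what remains is the Perron equation for \<open>v\<close>.\<close>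
      have "w i * B $$ (i, j) = z / rho B * cnj (x j / cmod (x j)) * of_real (v i * B $$ (i, j))"
        if i: "i < n" for i
      proof (cases "B $$ (i, j) = 0")
        case False
        have "cnj (x j / cmod (x j)) = cnj (z / rho B * (x i / cmod (x i)))"
          using peripheral_phase'[OF x z i j False] by simp
        hence "z / rho B * cnj (x j / cmod (x j)) =
            z * cnj z / (rho B)\<^sup>2 * cnj (x i / cmod (x i))"
          by (simp add: power2_eq_square mult_ac)
        also have "z * cnj z = (rho B)\<^sup>2"
          using z complex_norm_square[of z] by simp
        finally show ?thesis
          using rho_pos by (simp add: w_def)
      qed auto
      hence "(\<Sum>i<n. w i * B $$ (i, j)) =
          z / rho B * cnj (x j / cmod (x j)) * of_real (\<Sum>i<n. v i * B $$ (i, j))"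
        by (simp add: sum_distrib_left)
      also have "(\<Sum>i<n. v i * B $$ (i, j)) = rho B * v j"
        using v(2)[OF j] j by (simp add: mat_act_def mult.commute)
      finally show ?thesis
        using rho_pos by (simp add: w_def)
    qed
    have "(\<Sum>i<n. w i * mat_act B y i) = (\<Sum>i<n. \<Sum>j<n. w i * B $$ (i, j) * y j)"
      by (simp add: mat_act_def sum_distrib_left scaleR_conv_of_real mult_ac)
    also have "\<dots> = (\<Sum>j<n. (\<Sum>i<n. w i * B $$ (i, j)) * y j)"
      by (subst sum.swap) (simp add: sum_distrib_right)
    also have "\<dots> = z * (\<Sum>i<n. w i * y i)"
      by (simp add: col sum_distrib_left mult_ac)
    finally show ?thesis .
  qed
  ultimately show ?thesis by (rule that)
qed

section \<open>Simplicity and root structure of the peripheral spectrum\<close>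

text \<open>Triangularize with \<open>z\<close> in the first two places. The first two columns
  satisfy \<open>B p0 = z p0\<close> and \<open>B p1 = z p1 + t p0\<close>; pairing the second
  equation with the left eigenvector gives \<open>t = 0\<close>. So \<open>p1\<close> is an
  eigenvector too, hence a multiple of \<open>p0\<close>, against the invertibility of
  \<open>P\<close>.\<close>

lemma peripheral_simple:
  assumes "z \<in># eigvals B" and z: "cmod z = rho B"
  shows "count (eigvals B) z = 1"
proof (rule ccontr)
  assume "count (eigvals B) z \<noteq> 1"
  moreover have "count (eigvals B) z > 0"
    using assms(1) by simp
  ultimately have "2 \<le> count (eigvals B) z" by linarith
  hence "count {#z, z#} a \<le> count (eigvals B) a" for a
    by auto
  hence "{#z, z#} \<subseteq># eigvals B"
    by (simp add: subseteq_mset_def)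
  then obtain M where M: "eigvals B = {#z, z#} + M"
    by (metis subset_mset.add_diff_inverse)
  obtain ms where "mset ms = M" using ex_mset by blast
  with M have es: "mset (z # z # ms) = eigvals B" by simp
  obtain T P Q where sim: "similar_mat_wit (map_mat complex_of_real B) T P Q"
    and ut: "upper_triangular T" and diag: "diag_mat T = z # z # ms"
    using triangularization[OF carrier es] by blast
  define C where "C = map_mat complex_of_real B"
  have C: "C \<in> carrier_mat n n" using carrier by (simp add: C_def)
  note s = similar_mat_witD2[OF C sim[folded C_def]]
  have "length (diag_mat T) = n" using s by (simp add: diag_mat_def)
  hence n2: "1 < n" using diag by auto
  have "diag_mat T ! 0 = z" "diag_mat T ! 1 = z" using diag by auto
  hence T: "T $$ (0, 0) = z" "T $$ (1, 1) = z"
    using n2 s(5) by (auto simp: diag_mat_def)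
  have "C * P = P * T"
  proof -
    have "C * P = P * T * Q * P" using s(3) by simp
    also have "\<dots> = P * T * (Q * P)"
      using s by (intro assoc_mult_mat[of _ n n _ n _ n]) auto
    finally show ?thesis using s by simp
  qed
  hence CP: "mat_act B (\<lambda>l. P $$ (l, k)) i = (\<Sum>l<n. P $$ (i, l) * T $$ (l, k))"
    if "i < n" "k < n" for i k
  proof -
    have "(C * P) $$ (i, k) = mat_act B (\<lambda>l. P $$ (l, k)) i"
      using that s(6) C carrier unfolding C_def
      by (auto simp: scalar_prod_def mat_act_def scaleR_conv_of_real lessThan_atLeast0)
    moreover have "(P * T) $$ (i, k) = (\<Sum>l<n. P $$ (i, l) * T $$ (l, k))"
      using that s(5,6) by (auto simp: scalar_prod_def lessThan_atLeast0)
    ultimately show ?thesis using \<open>C * P = P * T\<close> by simp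
  qed
  define p0 where "p0 = (\<lambda>i. P $$ (i, 0))"
  define p1 where "p1 = (\<lambda>i. P $$ (i, 1))"
  define t where "t = T $$ (0, 1)"
  have T0: "T $$ (l, k) = 0" if "k < l" "l < n" for l k
    using ut that s(5) by (auto simp: upper_triangular_def)
  have p0: "mat_act B p0 i = z * p0 i" if "i < n" for i
  proof -
    have "(\<Sum>l<n. P $$ (i, l) * T $$ (l, 0)) = (\<Sum>l\<in>{0}. P $$ (i, l) * T $$ (l, 0))"
      using T0 n2 by (intro sum.mono_neutral_right) auto
    thus ?thesis
      using CP[of i 0] that n2 T by (simp add: p0_def mult.commute)
  qed
  have p1: "mat_act B p1 i = z * p1 i + t * p0 i" if "i < n" for i
  proof -
    have "(\<Sum>l<n. P $$ (i, l) * T $$ (l, 1)) = (\<Sum>l\<in>{0, 1}. P $$ (i, l) * T $$ (l, 1))"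
      using T0 n2 by (intro sum.mono_neutral_right) auto
    thus ?thesis
      using CP[of i 1] that n2 T by (simp add: p0_def p1_def t_def mult.commute)
  qed
  have QP: "(\<Sum>l<n. Q $$ (i, l) * P $$ (l, k)) = (if i = k then 1 else 0)" if "i < n" "k < n" for i k
  proof -
    have "(Q * P) $$ (i, k) = (\<Sum>l<n. Q $$ (i, l) * P $$ (l, k))"
      using that s(6,7) by (auto simp: scalar_prod_def lessThan_atLeast0)
    thus ?thesis using s(2) that by simp
  qed
  have "\<exists>i<n. p0 i \<noteq> 0"
  proof (rule ccontr)
    assume "\<not> ?thesis"
    thus False using QP[of 0 0] n2 by (simp add: p0_def)
  qed
  with p0 have ef0: "is_eigenfun B z p0" by (simp add: is_eigenfun_def)
  obtain w where w: "(\<Sum>i<n. w i * p0 i) \<noteq> 0"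
    "\<And>y. (\<Sum>i<n. w i * mat_act B y i) = z * (\<Sum>i<n. w i * y i)"
    using peripheral_left_eigenfun[OF ef0 z] by blast
  have "(\<Sum>i<n. w i * mat_act B p1 i) = z * (\<Sum>i<n. w i * p1 i) + t * (\<Sum>i<n. w i * p0 i)"
    by (simp add: p1 algebra_simps sum.distrib sum_distrib_left)
  with w have "t = 0" by simp
  moreover have "\<exists>i<n. p1 i \<noteq> 0"
  proof (rule ccontr)
    assume "\<not> ?thesis"
    thus False using QP[of 1 1] n2 by (simp add: p1_def)
  qed
  ultimately have "is_eigenfun B z p1" using p1 by (simp add: is_eigenfun_def)
  from peripheral_eigenfun_unique[OF ef0 this z]
  obtain c where c: "\<forall>i<n. p1 i = c * p0 i" by blast
  have "(\<Sum>l<n. Q $$ (1, l) * p1 l) = c * (\<Sum>l<n. Q $$ (1, l) * p0 l)"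
    using c by (simp add: sum_distrib_left mult_ac)
  thus False
    using QP[of 1 0] QP[of 1 1] n2 by (simp add: p0_def p1_def)
qed

text \<open>Twisting an eigenvector for \<open>z\<close> by the phases of one for \<open>z'\<close>
  multiplies the eigenvalue by \<open>z' / rho B\<close>.\<close>

lemma peripheral_mult:
  assumes "z \<in># eigvals B" "cmod z = rho B" and "z' \<in># eigvals B" "cmod z' = rho B"
  shows "z * z' / rho B \<in># eigvals B" "cmod (z * z' / rho B) = rho B"
proof -
  obtain x y where x: "is_eigenfun B z x" and y: "is_eigenfun B z' y"
    using assms in_eigvals_iff[OF carrier] by blast
  have nx: "\<forall>i<n. x i \<noteq> 0" and ny: "\<forall>i<n. y i \<noteq> 0"
    using cmod_peripheral_eigenfun(2) x y assms by auto
  define p where "p = (\<lambda>i. y i / cmod (y i))"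
  define w where "w = (\<lambda>i. x i * p i)"
  have "mat_act B w i = z * z' / rho B * w i" if i: "i < n" for i
  proof -
    have "B $$ (i, j) *\<^sub>R w j = z' / rho B * p i * (B $$ (i, j) *\<^sub>R x j)"
      if "j < n" for j
    proof (cases "B $$ (i, j) = 0")
      case False
      have "p j = z' / rho B * p i"
        unfolding p_def by (rule peripheral_phase'[OF y assms(4) i that False])
      thus ?thesis
        by (simp add: w_def scaleR_conv_of_real mult_ac)
    qed auto
    hence "mat_act B w i = z' / rho B * p i * mat_act B x i"
      unfolding mat_act_def sum_distrib_left by (intro sum.cong) auto
    thus ?thesis using x i by (simp add: w_def is_eigenfun_def)
  qed
  moreover have "\<exists>i<n. w i \<noteq> 0"
    using nx ny n_pos by (auto simp: w_def p_def)
  ultimately have "is_eigenfun B (z * z' / rho B) w"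
    by (simp add: is_eigenfun_def)
  thus "z * z' / rho B \<in># eigvals B" using in_eigvals_iff[OF carrier] by blast
  show "cmod (z * z' / rho B) = rho B"
    using assms rho_pos by (simp add: norm_mult norm_divide)
qed

text \<open>Multiplication by \<open>z / rho B\<close> permutes the finite set \<open>S\<close> of
  peripheral eigenvalues and so fixes the product over \<open>S\<close>; hence
  \<open>(z / rho B) ^ h = 1\<close> with \<open>h = card S\<close>. There are only \<open>h\<close>
  such numbers, so \<open>S\<close> contains all of them, each once by simplicity.\<close>

lemma peripheral_eigvals:
  shows "filter_mset (\<lambda>z. cmod z = rho B) (eigvals B) =
      mset_set {z. z ^ h_index B = of_real (rho B ^ h_index B)}" (is "?F = mset_set ?R")
    and h_index_pos: "0 < h_index B"
proof -
  define S where "S = {z \<in> set_mset (eigvals B). cmod z = rho B}"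
  define h where "h = h_index B"
  have fin: "finite S" by (simp add: S_def)
  have F: "?F = mset_set S"
  proof (rule multiset_eqI)
    fix z show "count ?F z = count (mset_set S) z"
      using peripheral_simple[of z] fin
      by (cases "z \<in> S") (auto simp: S_def not_in_iff[symmetric])
  qed
  hence h: "h = card S" by (simp add: h_def h_index_def)
  have "of_real (rho B) \<in> S"
    using rho_in_eigvals rho_pos by (simp add: S_def)
  with fin h show "0 < h_index B" by (auto simp: h_def card_gt_0_iff)
  hence hp: "0 < h" by (simp add: h_def)
  have S0: "z \<noteq> 0" if "z \<in> S" for z using that rho_pos by (auto simp: S_def)
  have "z ^ h = of_real (rho B ^ h)" if z: "z \<in> S" for z
  proof -
    have inj: "inj_on (\<lambda>t. z * t / rho B) S"
      using S0[OF z] rho_pos by (auto simp: inj_on_def)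
    have sub: "(\<lambda>t. z * t / rho B) ` S \<subseteq> S"
      using peripheral_mult z by (auto simp: S_def)
    hence "(\<lambda>t. z * t / rho B) ` S = S"
      using fin inj by (simp add: card_subset_eq card_image)
    hence "(\<Prod>t\<in>S. t) = (\<Prod>t\<in>S. z / rho B * t)"
      using prod.reindex[OF inj, of "\<lambda>t. t"] by simp
    also have "\<dots> = (z / rho B) ^ h * (\<Prod>t\<in>S. t)"
      by (simp add: prod.distrib h del: times_divide_eq_left)
    finally have "(z / rho B) ^ h = 1"
      using S0 fin by simp
    thus ?thesis using rho_pos by (simp add: power_divide)
  qed
  hence "S \<subseteq> {z. z ^ h = of_real (rho B ^ h)}" by auto
  moreover have "card {z. z ^ h = complex_of_real (rho B ^ h)} = h"
    using hp rho_pos by (intro card_nth_roots) auto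
  moreover have "finite {z. z ^ h = complex_of_real (rho B ^ h)}"
    using hp by (intro finite_nth_roots) auto
  ultimately have "S = {z. z ^ h = of_real (rho B ^ h)}"
    using h by (intro card_subset_eq) auto
  thus "?F = mset_set ?R"
    unfolding F h_def[symmetric] by (rule arg_cong)
qed

lemma row_nonzero:
  assumes i: "i < n"
  shows "\<exists>j<n. B $$ (i, j) \<noteq> 0"
proof (rule ccontr)
  assume "\<not> ?thesis"
  hence "mat_act B u i = 0" for u :: "nat \<Rightarrow> real"
    unfolding mat_act_def by (intro sum.neutral) auto
  moreover obtain u where "0 < u i" "mat_act B u i = rho B * u i"
    using perron_vector i by metis
  ultimately show False using rho_pos by simp
qed

lemma col_nonzero:
  assumes j: "j < n"
  shows "\<exists>i<n. B $$ (i, j) \<noteq> 0"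
  using nonneg_irreducible.row_nonzero[OF transpose j] j carrier by auto

end

section \<open>The second compound matrix\<close>

definition minor2 :: "'a::comm_ring_1 mat \<Rightarrow> nat \<times> nat \<Rightarrow> nat \<times> nat \<Rightarrow> 'a" where
  "minor2 A p q =
     A $$ (fst p, fst q) * A $$ (snd p, snd q) - A $$ (fst p, snd q) * A $$ (snd p, fst q)"

text \<open>Defined over any commutative ring because the triangular form and the transformation
  matrices are complex.\<close>

definition compound2 :: "'a::comm_ring_1 mat \<Rightarrow> 'a mat" where
  "compound2 A = (let n = dim_row A in
     mat (n choose 2) (n choose 2) (\<lambda>(\<alpha>, \<beta>). minor2 A (index_pairs n ! \<alpha>) (index_pairs n ! \<beta>)))"

lemma second_compound_eq_compound2: "second_compound A = compound2 A"
  by (simp add: second_compound_def compound2_def minor2_def Let_def case_prod_unfold)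

lemma compound2_carrier:
  "A \<in> carrier_mat n n \<Longrightarrow> compound2 A \<in> carrier_mat (n choose 2) (n choose 2)"
  by (auto simp: compound2_def Let_def)

lemma compound2_entry:
  assumes "A \<in> carrier_mat n n" "\<alpha> < n choose 2" "\<beta> < n choose 2"
  shows "compound2 A $$ (\<alpha>, \<beta>) = minor2 A (index_pairs n ! \<alpha>) (index_pairs n ! \<beta>)"
  using assms by (auto simp: compound2_def Let_def)

lemma index_pairs_nth:
  assumes "\<alpha> < n choose 2"
  shows "fst (index_pairs n ! \<alpha>) < snd (index_pairs n ! \<alpha>)" "snd (index_pairs n ! \<alpha>) < n"
    "fst (index_pairs n ! \<alpha>) < n"
proof -
  have "index_pairs n ! \<alpha> \<in> set (index_pairs n)"
    using assms by (simp add: length_index_pairs)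
  thus "fst (index_pairs n ! \<alpha>) < snd (index_pairs n ! \<alpha>)" "snd (index_pairs n ! \<alpha>) < n"
    "fst (index_pairs n ! \<alpha>) < n"
    by (auto simp: set_index_pairs)
qed

lemma map_mat_compound2:
  assumes "A \<in> carrier_mat n n"
  shows "map_mat complex_of_real (compound2 A) = compound2 (map_mat complex_of_real A)"
  using assms
  by (intro eq_matI) (auto simp: compound2_def Let_def minor2_def index_pairs_nth)

text \<open>Each pair contributes both of its orders, and the missing diagonal terms vanish. This
  turns sums over lexicographic numbers into free double sums.\<close>

lemma sum_index_pairs:
  fixes g :: "nat \<Rightarrow> nat \<Rightarrow> 'a::comm_ring_1"
  assumes "\<And>k. g k k = 0"
  shows "(\<Sum>\<beta><n choose 2. g (fst (index_pairs n ! \<beta>)) (snd (index_pairs n ! \<beta>)) +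
      g (snd (index_pairs n ! \<beta>)) (fst (index_pairs n ! \<beta>))) = (\<Sum>k<n. \<Sum>l<n. g k l)"
proof -
  let ?U = "{(k, l). k < l \<and> l < n}" and ?L = "{(k, l). l < k \<and> k < n}"
  have fin: "finite ?U" "finite ?L"
    by (rule finite_subset[of _ "{..<n} \<times> {..<n}"]; auto)+
  have bij: "bij_betw (\<lambda>\<beta>. index_pairs n ! \<beta>) {..<n choose 2} ?U"
    by (intro bij_betw_nth) (simp_all add: distinct_index_pairs length_index_pairs set_index_pairs)
  have "(\<Sum>\<beta><n choose 2. g (fst (index_pairs n ! \<beta>)) (snd (index_pairs n ! \<beta>)) +
      g (snd (index_pairs n ! \<beta>)) (fst (index_pairs n ! \<beta>))) =
      (\<Sum>p\<in>?U. g (fst p) (snd p) + g (snd p) (fst p))"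
    by (rule sum.reindex_bij_betw[OF bij])
  also have "\<dots> = (\<Sum>p\<in>?U. g (fst p) (snd p)) + (\<Sum>p\<in>?U. g (snd p) (fst p))"
    by (rule sum.distrib)
  also have "(\<Sum>p\<in>?U. g (snd p) (fst p)) = (\<Sum>p\<in>?L. g (fst p) (snd p))"
    by (rule sum.reindex_bij_witness[of _ prod.swap prod.swap]) auto
  also have "(\<Sum>p\<in>?U. g (fst p) (snd p)) + \<dots> = (\<Sum>p\<in>?U \<union> ?L. g (fst p) (snd p))"
    using fin by (intro sum.union_disjoint[symmetric]) auto
  also have "\<dots> = (\<Sum>p\<in>{..<n} \<times> {..<n}. g (fst p) (snd p))"
    using assms by (intro sum.mono_neutral_left) (auto, metis linorder_neqE_nat)
  also have "\<dots> = (\<Sum>k<n. \<Sum>l<n. g k l)"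
    by (simp add: sum.cartesian_product case_prod_unfold)
  finally show ?thesis .
qed

text \<open>The Cauchy--Binet formula for minors of order two.\<close>

lemma compound2_mult:
  assumes A: "A \<in> carrier_mat n n" and B: "B \<in> carrier_mat n n"
  shows "compound2 (A * B) = compound2 A * compound2 B"
proof (rule eq_matI)
  fix \<alpha> \<gamma>
  assume "\<alpha> < dim_row (compound2 A * compound2 B)" "\<gamma> < dim_col (compound2 A * compound2 B)"
  hence \<alpha>: "\<alpha> < n choose 2" and \<gamma>: "\<gamma> < n choose 2"
    using compound2_carrier[OF A] compound2_carrier[OF B] by auto
  define i j r s where "i = fst (index_pairs n ! \<alpha>)" "j = snd (index_pairs n ! \<alpha>)"
    "r = fst (index_pairs n ! \<gamma>)" "s = snd (index_pairs n ! \<gamma>)"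
  note lt = index_pairs_nth[OF \<alpha>, folded i_j_r_s_def] index_pairs_nth[OF \<gamma>, folded i_j_r_s_def]
  \<comment> \<open>The last factor is antisymmetric in \<open>k\<close> and \<open>l\<close>: it
    vanishes for \<open>k = l\<close>, and \<open>g k l + g l k\<close> is a minor of
    \<open>A\<close> times a minor of \<open>B\<close>.\<close>
  define g where "g = (\<lambda>k l. A $$ (i, k) * A $$ (j, l) *
    (B $$ (k, r) * B $$ (l, s) - B $$ (k, s) * B $$ (l, r)))"
  have AB: "(A * B) $$ (a, b) = (\<Sum>k<n. A $$ (a, k) * B $$ (k, b))" if "a < n" "b < n" for a b
    using A B that by (auto simp: scalar_prod_def lessThan_atLeast0)
  have "(compound2 A * compound2 B) $$ (\<alpha>, \<gamma>) =
      (\<Sum>\<beta><n choose 2. compound2 A $$ (\<alpha>, \<beta>) * compound2 B $$ (\<beta>, \<gamma>))"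
    using compound2_carrier[OF A] compound2_carrier[OF B] \<alpha> \<gamma>
    by (auto simp: scalar_prod_def lessThan_atLeast0)
  also have "\<dots> = (\<Sum>\<beta><n choose 2. g (fst (index_pairs n ! \<beta>)) (snd (index_pairs n ! \<beta>)) +
      g (snd (index_pairs n ! \<beta>)) (fst (index_pairs n ! \<beta>)))"
    using A B \<alpha> \<gamma>
    by (intro sum.cong refl)
      (simp add: compound2_entry minor2_def g_def i_j_r_s_def algebra_simps)
  also have "\<dots> = (\<Sum>k<n. \<Sum>l<n. g k l)"
    by (rule sum_index_pairs) (simp add: g_def)
  also have "\<dots> = (A * B) $$ (i, r) * (A * B) $$ (j, s) - (A * B) $$ (i, s) * (A * B) $$ (j, r)"
    using lt by (simp add: AB g_def sum_product sum_subtractf[symmetric] algebra_simps)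
  also have "\<dots> = compound2 (A * B) $$ (\<alpha>, \<gamma>)"
    using A B \<alpha> \<gamma> by (subst compound2_entry[of _ n]) (auto simp: minor2_def i_j_r_s_def)
  finally show "compound2 (A * B) $$ (\<alpha>, \<gamma>) = (compound2 A * compound2 B) $$ (\<alpha>, \<gamma>)" ..
qed (use A B in \<open>auto simp: compound2_def Let_def\<close>)

lemma compound2_one: "compound2 (1\<^sub>m n) = 1\<^sub>m (n choose 2)"
proof (rule eq_matI)
  fix \<alpha> \<beta>
  assume "\<alpha> < dim_row (1\<^sub>m (n choose 2) :: 'a mat)" "\<beta> < dim_col (1\<^sub>m (n choose 2) :: 'a mat)"
  hence lt: "\<alpha> < n choose 2" "\<beta> < n choose 2" by auto
  have "index_pairs n ! \<alpha> = index_pairs n ! \<beta> \<longleftrightarrow> \<alpha> = \<beta>"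
    using lt by (simp add: nth_eq_iff_index_eq[OF distinct_index_pairs] length_index_pairs)
  thus "compound2 (1\<^sub>m n) $$ (\<alpha>, \<beta>) = (1\<^sub>m (n choose 2) :: 'a mat) $$ (\<alpha>, \<beta>)"
    using lt index_pairs_nth[OF lt(1)] index_pairs_nth[OF lt(2)]
    by (subst compound2_entry[of _ n]) (auto simp: minor2_def prod_eq_iff)
qed (auto simp: compound2_def Let_def)

text \<open>The lexicographic order is what makes this work. Let the columns \<open>(k, l)\<close>
  precede the rows \<open>(i, j)\<close>. If \<open>k < i\<close>, then column \<open>k\<close> is
  zero in both rows; if \<open>k = i\<close> and \<open>l < j\<close>, then row \<open>j\<close> is
  zero in both columns.\<close>

lemma compound2_upper_triangular:
  assumes T: "T \<in> carrier_mat n n" and ut: "upper_triangular T"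
  shows "upper_triangular (compound2 T)"
    "diag_mat (compound2 T) = map (\<lambda>(i, j). diag_mat T ! i * diag_mat T ! j) (index_pairs n)"
proof -
  have T0: "T $$ (i, j) = 0" if "j < i" "i < n" for i j
    using ut T that by (auto simp: upper_triangular_def)
  show "upper_triangular (compound2 T)"
  proof (rule upper_triangularI)
    fix \<beta> \<alpha>
    assume "\<beta> < \<alpha>" "\<alpha> < dim_row (compound2 T)"
    hence lt: "\<beta> < \<alpha>" "\<alpha> < n choose 2" "\<beta> < n choose 2"
      using compound2_carrier[OF T] by auto
    have "fst (index_pairs n ! \<beta>) < fst (index_pairs n ! \<alpha>) \<or>
        fst (index_pairs n ! \<beta>) = fst (index_pairs n ! \<alpha>) \<and>
        snd (index_pairs n ! \<beta>) < snd (index_pairs n ! \<alpha>)"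
      using sorted_wrt_nth_less[OF sorted_index_pairs lt(1)] lt
      by (auto simp: length_index_pairs case_prod_unfold)
    thus "compound2 T $$ (\<alpha>, \<beta>) = 0"
      using index_pairs_nth[OF lt(2)] index_pairs_nth[OF lt(3)] lt
      by (auto simp: compound2_entry[OF T] minor2_def T0)
  qed
  show "diag_mat (compound2 T) = map (\<lambda>(i, j). diag_mat T ! i * diag_mat T ! j) (index_pairs n)"
  proof (rule nth_equalityI)
    fix \<alpha> assume "\<alpha> < length (diag_mat (compound2 T))"
    hence \<alpha>: "\<alpha> < n choose 2"
      using compound2_carrier[OF T] by (auto simp: diag_mat_def)
    thus "diag_mat (compound2 T) ! \<alpha> =
        map (\<lambda>(i, j). diag_mat T ! i * diag_mat T ! j) (index_pairs n) ! \<alpha>"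
      using index_pairs_nth[OF \<alpha>] compound2_carrier[OF T] T
      by (auto simp: diag_mat_def length_index_pairs case_prod_unfold compound2_entry minor2_def T0)
  qed (use compound2_carrier[OF T] in \<open>auto simp: diag_mat_def length_index_pairs\<close>)
qed

section \<open>Eigenvalues and eigenvectors of the compound\<close>

text \<open>Recursive, so that the products involving the leading eigenvalues of a list unfold by
  simplification.\<close>

fun pair_products :: "'a::times list \<Rightarrow> 'a list" where
  "pair_products [] = []"
| "pair_products (x # xs) = map ((*) x) xs @ pair_products xs"

lemma index_pairs_Suc:
  "index_pairs (Suc n) = map (Pair 0) [1..<Suc n] @ map (map_prod Suc Suc) (index_pairs n)"
proof -
  have "[0..<Suc n] = 0 # map Suc [0..<n]"
    by (simp add: upt_conv_Cons map_Suc_upt del: upt_Suc)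
  moreover have "map (Pair (Suc i)) [Suc (Suc i)..<Suc n] =
      map (map_prod Suc Suc) (map (Pair i) [Suc i..<n])" for i
    by (simp add: map_Suc_upt[symmetric] o_def del: upt_Suc)
  ultimately show ?thesis
    by (simp add: index_pairs_def map_concat o_def del: upt_Suc)
qed

lemma pair_products_index_pairs:
  "map (\<lambda>(i, j). xs ! i * xs ! j) (index_pairs (length xs)) = pair_products xs"
proof (induction xs)
  case (Cons x xs)
  have tail: "map (\<lambda>j. (x # xs) ! j) [1..<Suc (length xs)] = xs"
    by (rule nth_equalityI) (auto simp del: upt_Suc)
  have "map (\<lambda>(i, j). (x # xs) ! i * (x # xs) ! j) (map (Pair 0) [1..<Suc (length xs)])
      = map ((*) x) (map (\<lambda>j. (x # xs) ! j) [1..<Suc (length xs)])"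
    by (simp del: upt_Suc)
  also have "\<dots> = map ((*) x) xs"
    by (simp only: tail)
  finally have head: "map (\<lambda>(i, j). (x # xs) ! i * (x # xs) ! j)
      (map (Pair 0) [1..<Suc (length xs)]) = map ((*) x) xs" .
  have "map (\<lambda>(i, j). (x # xs) ! i * (x # xs) ! j)
      (map (map_prod Suc Suc) (index_pairs (length xs))) = pair_products xs"
    unfolding Cons.IH[symmetric] by (auto simp: case_prod_unfold)
  with head show ?case
    unfolding list.size(4) add_Suc_right add_0_right index_pairs_Suc map_append
    by simp
qed (simp add: index_pairs_def)

text \<open>Since the compound is multiplicative, a similarity of \<open>A\<close> with a triangular
  matrix induces one of the compounds, and the eigenvalues can be read off the diagonal.\<close>

lemma eigvals_compound2:
  assumes A: "A \<in> carrier_mat n n" and es: "mset es = eigvals A"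
  shows "eigvals (compound2 A) = mset (pair_products es)"
proof -
  define C where "C = map_mat complex_of_real A"
  have C: "C \<in> carrier_mat n n" using A by (simp add: C_def)
  obtain T P Q where sim: "similar_mat_wit C T P Q" and ut: "upper_triangular T"
    and diag: "diag_mat T = es"
    using triangularization[OF A es] unfolding C_def by blast
  note s = similar_mat_witD2[OF C sim]
  have C2: "compound2 C = compound2 P * compound2 T * compound2 Q"
    using s(3,5-7) compound2_mult[of P n T] compound2_mult[of "P * T" n Q] by simp
  have inv: "compound2 P * compound2 Q = 1\<^sub>m (n choose 2)"
    "compound2 Q * compound2 P = 1\<^sub>m (n choose 2)"
    using s compound2_mult[of P n Q] compound2_mult[of Q n P] by (simp_all add: compound2_one)
  have "similar_mat_wit (compound2 C) (compound2 T) (compound2 P) (compound2 Q)"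
    by (intro similar_mat_witI[OF inv C2] compound2_carrier C s)
  hence "char_poly (compound2 C) = char_poly (compound2 T)"
    by (intro char_poly_similar) (auto simp: similar_mat_def)
  also have "\<dots> = (\<Prod>a\<leftarrow>diag_mat (compound2 T). [:- a, 1:])"
    using compound2_carrier[OF s(5)] compound2_upper_triangular(1)[OF s(5) ut]
    by (rule char_poly_upper_triangular)
  also have "diag_mat (compound2 T) = pair_products es"
  proof -
    have "length es = n" using diag s(5) by (auto simp: diag_mat_def)
    thus ?thesis
      using compound2_upper_triangular(2)[OF s(5) ut] diag
      by (simp add: pair_products_index_pairs[symmetric])
  qed
  finally show ?thesis
    using A by (intro eigvals_of_factorization) (simp add: C_def map_mat_compound2)
qed

definition wedge :: "nat \<Rightarrow> (nat \<Rightarrow> real) \<Rightarrow> (nat \<Rightarrow> real) \<Rightarrow> nat \<Rightarrow> real" where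
  "wedge n u v \<alpha> = u (fst (index_pairs n ! \<alpha>)) * v (snd (index_pairs n ! \<alpha>)) -
     u (snd (index_pairs n ! \<alpha>)) * v (fst (index_pairs n ! \<alpha>))"

text \<open>The rule that the exterior square of \<open>A\<close> sends \<open>u \<and> v\<close> to
  \<open>A u \<and> A v\<close>, in the coordinates of the basis of pairs.\<close>

lemma mat_act_compound2_wedge:
  assumes A: "A \<in> carrier_mat n n" and \<alpha>: "\<alpha> < n choose 2"
  shows "mat_act (compound2 A) (wedge n u v) \<alpha> = wedge n (mat_act A u) (mat_act A v) \<alpha>"
proof -
  define i j where "i = fst (index_pairs n ! \<alpha>)" "j = snd (index_pairs n ! \<alpha>)"
  define g where "g = (\<lambda>k l. A $$ (i, k) * A $$ (j, l) * (u k * v l - u l * v k))"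
  have "mat_act (compound2 A) (wedge n u v) \<alpha> =
      (\<Sum>\<beta><n choose 2. g (fst (index_pairs n ! \<beta>)) (snd (index_pairs n ! \<beta>)) +
      g (snd (index_pairs n ! \<beta>)) (fst (index_pairs n ! \<beta>)))"
    using compound2_carrier[OF A] \<alpha> unfolding mat_act_def
    by (intro sum.cong)
      (auto simp: compound2_entry[OF A] minor2_def g_def i_j_def wedge_def algebra_simps)
  also have "\<dots> = (\<Sum>k<n. \<Sum>l<n. g k l)"
    by (rule sum_index_pairs) (simp add: g_def)
  also have "\<dots> = mat_act A u i * mat_act A v j - mat_act A v i * mat_act A u j"
    unfolding mat_act_def g_def sum_product sum_subtractf[symmetric] using A
    by (simp add: algebra_simps)
  also have "\<dots> = wedge n (mat_act A u) (mat_act A v) \<alpha>"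
    by (simp add: wedge_def i_j_def mult.commute)
  finally show ?thesis .
qed

lemma in_pair_productsE:
  assumes "y \<in> set (pair_products xs)"
  obtains x x' where "x \<in> set xs" "x' \<in> set xs" "y = x * x'"
proof -
  have "\<exists>x x'. x \<in> set xs \<and> x' \<in> set xs \<and> y = x * x'"
    using assms
  proof (induction xs)
    case (Cons a as)
    show ?case
    proof (cases "y \<in> set (pair_products as)")
      case True
      with Cons.IH show ?thesis by (meson list.set_intros(2))
    next
      case False
      with Cons.prems obtain x' where "x' \<in> set as" "y = a * x'" by auto
      thus ?thesis by (intro exI[of _ a] exI[of _ x']) simp
    qed
  qed auto
  thus ?thesis using that by metis
qed

lemma cmod_pair_products_le:
  assumes "y \<in> set (pair_products xs)" "\<And>x. x \<in> set xs \<Longrightarrow> cmod x \<le> c"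
  shows "cmod y \<le> c * c"
  using assms(1)
proof (rule in_pair_productsE)
  fix x x' assume "x \<in> set xs" "x' \<in> set xs" "y = x * x'"
  moreover from this have "cmod x \<le> c" "cmod x' \<le> c" using assms(2) by auto
  moreover from this(1) have "0 \<le> c" using norm_ge_zero[of x] by linarith
  ultimately show "cmod y \<le> c * c"
    by (simp add: norm_mult mult_mono)
qed

lemma cmod_pair_products_less:
  assumes "y \<in> set (pair_products xs)" "\<And>x. x \<in> set xs \<Longrightarrow> cmod x < c"
  shows "cmod y < c * c"
  using assms(1)
proof (rule in_pair_productsE)
  fix x x' assume "x \<in> set xs" "x' \<in> set xs" "y = x * x'"
  thus "cmod y < c * c"
    using assms(2) by (auto simp: norm_mult intro!: mult_strict_mono')
qed

section \<open>Irreducible sign-symmetric matrices\<close>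

lemma mult_mat_entry:
  assumes "A \<in> carrier_mat n n" "B \<in> carrier_mat n n" "i < n" "j < n"
  shows "(A * B) $$ (i, j) = (\<Sum>k = 0..<n. A $$ (i, k) * B $$ (k, j))"
  using assms by (auto simp: scalar_prod_def)

text \<open>Number the indices of \<open>S\<close> first; the zero entries then form the upper right
  block. The contrapositive supplies \<open>connected\<close>.\<close>

lemma reducible_matI:
  assumes B: "B \<in> carrier_mat n n" and S: "S \<subseteq> {..<n}" "S \<noteq> {}" "S \<noteq> {..<n}"
    and zero: "\<And>i j. i \<in> S \<Longrightarrow> j \<in> {..<n} - S \<Longrightarrow> B $$ (i, j) = 0"
  shows "reducible_mat B"
proof -
  define k where "k = card S"
  have fin: "finite S" using S(1) finite_subset by blast
  have k: "0 < k" "k < n"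
    using S fin psubset_card_mono[of "{..<n}" S] by (auto simp: k_def card_gt_0_iff)
  obtain g1 where g1: "bij_betw g1 {..<k} S"
    using finite_same_card_bij[of "{..<k}" S] fin by (auto simp: k_def)
  have "card ({..<n} - S) = card {k..<n}"
    using S(1) fin by (simp add: card_Diff_subset k_def)
  then obtain g2 where g2: "bij_betw g2 {k..<n} ({..<n} - S)"
    using finite_same_card_bij[of "{k..<n}" "{..<n} - S"] by auto
  \<comment> \<open>The identity beyond \<open>n\<close> is required by
    \<open>permutes\<close>.\<close>
  define f where "f = (\<lambda>x. if x < k then g1 x else if x < n then g2 x else x)"
  have f1: "f x \<in> S" if "x < k" for x
    using g1 that by (auto simp: f_def bij_betw_def)
  have f2: "f x \<in> {..<n} - S" if "k \<le> x" "x < n" for x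
    using g2 that by (auto simp: f_def bij_betw_def)
  have "bij_betw f ({..<k} \<union> {k..<n}) (S \<union> ({..<n} - S))"
  proof (rule bij_betw_combine)
    show "bij_betw f {..<k} S"
      using g1 by (rule bij_betw_cong[THEN iffD1, rotated]) (auto simp: f_def)
    show "bij_betw f {k..<n} ({..<n} - S)"
      using g2 by (rule bij_betw_cong[THEN iffD1, rotated]) (auto simp: f_def)
  qed auto
  moreover have "{..<k} \<union> {k..<n} = {..<n}" "S \<union> ({..<n} - S) = {..<n}"
    using k S(1) by auto
  ultimately have bij: "bij_betw f {..<n} {..<n}" by simp
  hence perm: "f permutes {..<n}"
    using k by (intro bij_imp_permutes) (auto simp: f_def)
  have fn: "f x < n" if "x < n" for x
    using bij that by (auto simp: bij_betw_def)
  have inj: "f x = f y \<longleftrightarrow> x = y" if "x < n" "y < n" for x y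
    using bij that by (auto simp: bij_betw_def inj_on_def)
  define P where "P = mat n n (\<lambda>(i, j). if i = f j then 1 else 0 :: real)"
  define Q where "Q = mat n n (\<lambda>(i, j). if j = f i then 1 else 0 :: real)"
  have P: "P \<in> carrier_mat n n" and Q: "Q \<in> carrier_mat n n"
    by (auto simp: P_def Q_def)
  have QP: "Q * P = 1\<^sub>m n"
    by (rule eq_matI) (auto simp: P_def Q_def scalar_prod_def fn inj if_distrib[of "\<lambda>x. x * _"] cong: if_cong)
  have PQ: "P * Q = 1\<^sub>m n"
    using mat_mult_left_right_inverse[OF Q P QP] .
  have QBP: "Q * B * P = mat n n (\<lambda>(a, b). B $$ (f a, f b))"
  proof (rule eq_matI)
    fix a b
    assume "a < dim_row (mat n n (\<lambda>(a, b). B $$ (f a, f b)))"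
      "b < dim_col (mat n n (\<lambda>(a, b). B $$ (f a, f b)))"
    hence ab: "a < n" "b < n" by auto
    have QB: "(Q * B) $$ (a, j) = B $$ (f a, j)" if "j < n" for j
      using B ab that
      by (auto simp: Q_def scalar_prod_def fn if_distrib[of "\<lambda>x. x * _"] cong: if_cong)
    have "(Q * B * P) $$ (a, b) = (\<Sum>j = 0..<n. (Q * B) $$ (a, j) * P $$ (j, b))"
      using ab by (intro mult_mat_entry mult_carrier_mat[OF Q B] P)
    also have "\<dots> = (\<Sum>j = 0..<n. if j = f b then B $$ (f a, j) else 0)"
      using ab by (intro sum.cong) (auto simp: QB P_def)
    also have "\<dots> = B $$ (f a, f b)"
      using ab by (simp add: fn)
    finally show "(Q * B * P) $$ (a, b) = mat n n (\<lambda>(a, b). B $$ (f a, f b)) $$ (a, b)"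
      using ab by simp
  qed (use B P Q in auto)
  define M where "M = (\<lambda>a b. B $$ (f a, f b))"
  define B1 B2 C where "B1 = mat k k (\<lambda>(a, b). M a b)"
    "B2 = mat (n - k) (n - k) (\<lambda>(a, b). M (a + k) (b + k))"
    "C = mat (n - k) k (\<lambda>(a, b). M (a + k) b)"
  have block: "Q * B * P = four_block_mat B1 (0\<^sub>m k (n - k)) C B2"
    unfolding QBP
  proof (rule eq_matI)
    fix a b
    assume "a < dim_row (four_block_mat B1 (0\<^sub>m k (n - k)) C B2)"
      "b < dim_col (four_block_mat B1 (0\<^sub>m k (n - k)) C B2)"
    hence ab: "a < n" "b < n" using k by (auto simp: B1_B2_C_def)
    have "M a b = 0" if "a < k" "k \<le> b"
      unfolding M_def using f1[OF that(1)] f2[OF that(2) ab(2)] by (rule zero)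
    thus "mat n n (\<lambda>(a, b). B $$ (f a, f b)) $$ (a, b) =
        four_block_mat B1 (0\<^sub>m k (n - k)) C B2 $$ (a, b)"
      using ab k by (auto simp: M_def B1_B2_C_def)
  qed (use k in \<open>auto simp: B1_B2_C_def\<close>)
  have dimB: "dim_row B = n" using B by simp
  have "permutation_mat n P"
    using perm by (auto simp: permutation_mat_def P_def)
  moreover have "inverts_mat P Q" "inverts_mat Q P"
    using P Q PQ QP by (auto simp: inverts_mat_def)
  moreover have "B1 \<in> carrier_mat k k" "B2 \<in> carrier_mat (n - k) (n - k)" "C \<in> carrier_mat (n - k) k"
    by (auto simp: B1_B2_C_def)
  moreover have "0 < n - k" using k by simp
  ultimately show ?thesis
    unfolding reducible_mat_def dimB using Q k(1) block by blast
qed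

definition sign_of :: "nat set \<Rightarrow> nat \<Rightarrow> real" where
  "sign_of J i = (if i \<in> J then - 1 else 1)"

text \<open>This is \<open>D A D\<close> for the diagonal matrix \<open>D\<close> of signs. As
  \<open>D\<close> is its own inverse, it is a similarity.\<close>

definition sign_conj :: "nat set \<Rightarrow> real mat \<Rightarrow> real mat" where
  "sign_conj J A = mat (dim_row A) (dim_row A) (\<lambda>(i, j). sign_of J i * sign_of J j * A $$ (i, j))"

lemma sign_of_mult_self [simp]: "sign_of J i * sign_of J i = 1" "sign_of J i * (sign_of J i * x) = x"
  by (auto simp: sign_of_def)

lemma sign_of_neq_0 [simp]: "sign_of J i \<noteq> 0"
  by (auto simp: sign_of_def)

lemma sign_conj_carrier: "A \<in> carrier_mat n n \<Longrightarrow> sign_conj J A \<in> carrier_mat n n"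
  by (auto simp: sign_conj_def)

lemma sign_conj_entry:
  "A \<in> carrier_mat n n \<Longrightarrow> i < n \<Longrightarrow> j < n \<Longrightarrow>
    sign_conj J A $$ (i, j) = sign_of J i * sign_of J j * A $$ (i, j)"
  by (auto simp: sign_conj_def)

lemma eigvals_sign_conj:
  assumes A: "A \<in> carrier_mat n n"
  shows "eigvals (sign_conj J A) = eigvals A"
proof -
  define D where "D = mat n n (\<lambda>(i, j). if i = j then sign_of J i else 0)"
  have D: "D \<in> carrier_mat n n" by (simp add: D_def)
  have DD: "D * D = 1\<^sub>m n"
    by (rule eq_matI) (auto simp: D_def scalar_prod_def if_distrib[of "\<lambda>x. x * _"] cong: if_cong)
  have "sign_conj J A = D * A * D"
  proof (rule eq_matI)
    fix i j assume "i < dim_row (D * A * D)" "j < dim_col (D * A * D)"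
    hence ij: "i < n" "j < n" using D by auto
    have Dk: "D $$ (k, j) = (if k = j then sign_of J j else 0)" if "k < n" for k
      using ij that by (simp add: D_def)
    have DA: "(D * A) $$ (i, k) = sign_of J i * A $$ (i, k)" if "k < n" for k
    proof -
      have "(D * A) $$ (i, k) = (\<Sum>l = 0..<n. D $$ (i, l) * A $$ (l, k))"
        by (rule mult_mat_entry[OF D A ij(1) that])
      also have "\<dots> = (\<Sum>l = 0..<n. if l = i then sign_of J i * A $$ (l, k) else 0)"
        using ij by (intro sum.cong) (auto simp: D_def)
      finally show ?thesis
        using ij by simp
    qed
    have "(D * A * D) $$ (i, j) = (\<Sum>k = 0..<n. (D * A) $$ (i, k) * D $$ (k, j))"
      using ij by (intro mult_mat_entry mult_carrier_mat[OF D A] D)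
    also have "\<dots> = (\<Sum>k = 0..<n. if k = j then sign_of J i * A $$ (i, k) * sign_of J j else 0)"
      using ij by (intro sum.cong) (auto simp: DA Dk)
    also have "\<dots> = sign_of J i * A $$ (i, j) * sign_of J j"
      using ij by simp
    finally show "sign_conj J A $$ (i, j) = (D * A * D) $$ (i, j)"
      using A ij by (simp add: sign_conj_entry mult_ac)
  qed (use A D in \<open>auto simp: sign_conj_def\<close>)
  hence "similar_mat_wit (sign_conj J A) A D D"
    by (intro similar_mat_witI[OF DD DD] sign_conj_carrier A D)
  hence "similar_mat (sign_conj J A) A"
    by (auto simp: similar_mat_def)
  hence "char_poly (sign_conj J A) = char_poly A"
    by (rule char_poly_similar)
  thus ?thesis
    using A sign_conj_carrier[OF A, of J]
    by (simp add: eigvals_def of_real_hom.char_poly_hom)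
qed

lemma rho_eqI:
  assumes "A \<in> carrier_mat n n" "B \<in> carrier_mat n n" "eigvals A = eigvals B"
  shows "rho A = rho B" "h_index A = h_index B"
proof -
  show "rho A = rho B"
    using assms set_eigvals[of A n] set_eigvals[of B n] by (simp add: rho_def spectral_radius_def)
  thus "h_index A = h_index B"
    using assms by (simp add: h_index_def)
qed

text \<open>Every nonzero entry of \<open>A\<close> has the sign
  \<open>sign_of J i * sign_of J j\<close>, which the conjugation cancels; the positions of the
  zeros stay the same.\<close>

lemma nonneg_irreducible_sign_conj:
  assumes A: "A \<in> carrier_mat n n" and n: "n > 0" and irr: "irreducible_mat A"
    and J: "sign_symmetric_witness A J"
  shows "nonneg_irreducible (sign_conj J A) n"
proof
  show "sign_conj J A \<in> carrier_mat n n" by (rule sign_conj_carrier[OF A])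
  show "0 \<le> sign_conj J A $$ (i, j)" if "i < n" "j < n" for i j
  proof -
    have "(i \<in> J) \<noteq> (j \<in> J) \<Longrightarrow> A $$ (i, j) \<le> 0" "(i \<in> J) = (j \<in> J) \<Longrightarrow> 0 \<le> A $$ (i, j)"
      using J A that unfolding sign_symmetric_witness_def by (auto simp: not_less[symmetric])
    thus ?thesis
      using that by (auto simp: sign_conj_entry[OF A] sign_of_def)
  qed
  show *: "\<exists>i\<in>S. \<exists>j\<in>{..<n} - S. sign_conj J A $$ (i, j) \<noteq> 0"
    if S: "S \<subseteq> {..<n}" "S \<noteq> {}" "S \<noteq> {..<n}" for S
  proof -
    obtain i j where "i \<in> S" "j \<in> {..<n} - S" "A $$ (i, j) \<noteq> 0"
      using reducible_matI[OF A S] irr by (auto simp: irreducible_mat_def)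
    moreover from this S(1) have "sign_conj J A $$ (i, j) \<noteq> 0"
      using A by (auto simp: sign_conj_entry)
    ultimately show ?thesis by blast
  qed
  show "\<exists>i<n. \<exists>j<n. sign_conj J A $$ (i, j) \<noteq> 0"
  proof (cases "n = 1")
    case True
    have "A $$ (0, 0) \<noteq> 0"
    proof
      assume "A $$ (0, 0) = 0"
      hence "A = 0\<^sub>m 1 1" using A True by (intro eq_matI) auto
      thus False using irr by (simp add: irreducible_mat_def)
    qed
    thus ?thesis
      using True by (intro exI[of _ 0]) (simp add: sign_conj_entry[OF A])
  next
    case False
    hence "0 \<in> {..<n}" "1 \<in> {..<n}" using n by auto
    hence "{0} \<subseteq> {..<n}" "{0} \<noteq> {..<n}" by auto
    from *[OF this(1) _ this(2)] obtain j where "j < n" "sign_conj J A $$ (0, j) \<noteq> 0"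
      by auto
    thus ?thesis using n by blast
  qed
qed

section \<open>Transitivity and the leading eigenvalues\<close>

lemma mat_act_sign_conj:
  fixes x :: "nat \<Rightarrow> real"
  assumes A: "A \<in> carrier_mat n n" and i: "i < n"
  shows "mat_act (sign_conj J A) (\<lambda>j. sign_of J j * x j) i = sign_of J i * mat_act A x i"
    "mat_act A (\<lambda>j. sign_of J j * x j) i = sign_of J i * mat_act (sign_conj J A) x i"
proof -
  have dims: "dim_row A = n" "dim_row (sign_conj J A) = n"
    using A sign_conj_carrier[OF A, of J] by auto
  show "mat_act (sign_conj J A) (\<lambda>j. sign_of J j * x j) i = sign_of J i * mat_act A x i"
    unfolding mat_act_def dims sum_distrib_left using i
    by (intro sum.cong) (auto simp: sign_conj_entry[OF A] sign_of_def)
  show "mat_act A (\<lambda>j. sign_of J j * x j) i = sign_of J i * mat_act (sign_conj J A) x i"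
    unfolding mat_act_def dims sum_distrib_left using i
    by (intro sum.cong) (auto simp: sign_conj_entry[OF A] sign_of_def)
qed

locale sign_symmetric_compound =
  fixes n :: nat and A :: "real mat" and J Jt :: "nat set"
  assumes n2: "n \<ge> 2"
    and A: "A \<in> carrier_mat n n"
    and irr_A: "irreducible_mat A"
    and irr_A2: "irreducible_mat (second_compound A)"
    and J: "sign_symmetric_witness A J"
    and Jt: "sign_symmetric_witness (second_compound A) Jt"
begin

abbreviation "A2 \<equiv> second_compound A"

lemma choose_pos: "0 < n choose 2"
  using n2 by (simp add: zero_less_binomial_iff)

sublocale B: nonneg_irreducible "sign_conj J A" n
  using nonneg_irreducible_sign_conj[OF A _ irr_A J] n2 by simp

sublocale C: nonneg_irreducible "sign_conj Jt A2" "n choose 2"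
  using nonneg_irreducible_sign_conj[OF second_compound_carrier[OF A] choose_pos irr_A2 Jt] .

lemma eigvals_B: "eigvals (sign_conj J A) = eigvals A"
  by (rule eigvals_sign_conj[OF A])

lemma eigvals_C: "eigvals (sign_conj Jt A2) = eigvals A2"
  by (rule eigvals_sign_conj[OF second_compound_carrier[OF A]])

lemma rho_B: "rho (sign_conj J A) = rho A" and h_index_B: "h_index (sign_conj J A) = h_index A"
  using rho_eqI[OF B.carrier A eigvals_B] by auto

lemma rho_C: "rho (sign_conj Jt A2) = rho A2" and h_index_C: "h_index (sign_conj Jt A2) = h_index A2"
  using rho_eqI[OF C.carrier second_compound_carrier[OF A] eigvals_C] by auto

text \<open>\<open>orient i j\<close> is the sign relating the minors in rows \<open>i, j\<close> of the nonnegative matrix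
  \<open>sign_conj J A\<close> to the entries of \<open>sign_conj Jt A2\<close>.\<close>

definition orient :: "nat \<Rightarrow> nat \<Rightarrow> real" where
  "orient i j = (if i < j then 1 else - 1) * sign_of J i * sign_of J j *
     sign_of Jt (pair_number n (min i j, max i j))"

lemma orient_swap: "i \<noteq> j \<Longrightarrow> orient i j = - orient j i"
  by (auto simp: orient_def min_def max_def)

lemma orient_cases: "orient i j = 1 \<or> orient i j = - 1"
  by (auto simp: orient_def sign_of_def)

text \<open>The four clauses for distinct indices are the sign patterns with product -1. Since
  \<open>orient\<close> changes sign under a swap, exactly one of \<open>(i, j)\<close> and
  \<open>(j, i)\<close> satisfies them.\<close>

lemma W_hat_iff_orient:
  "(i, j) \<in> W_hat n J Jt \<longleftrightarrow> i < n \<and> j < n \<and> (i = j \<or> orient i j = - 1)"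
  by (cases i j rule: linorder_cases) (auto simp: W_hat_def orient_def sign_of_def min_def max_def)

text \<open>For increasing pairs the expression is an entry of the nonnegative matrix
  \<open>sign_conj Jt A2\<close>. The other orders follow because minors and \<open>orient\<close>
  are both antisymmetric.\<close>

lemma oriented_minor_nonneg:
  assumes ij: "i < n" "j < n" "i \<noteq> j" and kl: "k < n" "l < n" "k \<noteq> l"
  shows "0 \<le> orient i j * orient k l *
    (sign_conj J A $$ (i, k) * sign_conj J A $$ (j, l) -
     sign_conj J A $$ (i, l) * sign_conj J A $$ (j, k))" (is "0 \<le> ?P i j k l")
proof -
  have less: "0 \<le> ?P i j k l" if ij: "i < j" "j < n" and kl: "k < l" "l < n" for i j k l
  proof -
    define \<alpha> \<beta> where "\<alpha> = pair_number n (i, j)" "\<beta> = pair_number n (k, l)"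
    note \<alpha> = pair_number[OF ij, folded \<alpha>_\<beta>_def] and \<beta> = pair_number[OF kl, folded \<alpha>_\<beta>_def]
    have "0 \<le> sign_conj Jt A2 $$ (\<alpha>, \<beta>)"
      by (rule C.nonneg[OF \<alpha>(1) \<beta>(1)])
    also have "\<dots> = sign_of Jt \<alpha> * sign_of Jt \<beta> * minor2 A (i, j) (k, l)"
      using \<alpha> \<beta> A
      by (simp add: sign_conj_entry[OF compound2_carrier[OF A]] second_compound_eq_compound2
          compound2_entry[OF A])
    also have "\<dots> = ?P i j k l"
      using ij kl
      by (simp add: minor2_def sign_conj_entry[OF A] orient_def \<alpha>_\<beta>_def[symmetric] algebra_simps)
    finally show ?thesis .
  qed
  have swap1: "?P i j k l = ?P j i k l" and swap2: "?P i j k l = ?P i j l k"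
    using orient_swap[OF ij(3)] orient_swap[OF kl(3)] by (simp_all add: algebra_simps)
  have swap12: "?P i j k l = ?P j i l k"
    using orient_swap[OF ij(3)] orient_swap[OF kl(3)] by (simp add: algebra_simps)
  from ij(3) kl(3) consider "i < j" "k < l" | "i < j" "l < k" | "j < i" "k < l" | "j < i" "l < k"
    by linarith
  thus ?thesis
  proof cases
    case 1 show ?thesis by (rule less) (use 1 ij kl in auto)
  next
    case 2 show ?thesis unfolding swap2 by (rule less) (use 2 ij kl in auto)
  next
    case 3 show ?thesis unfolding swap1 by (rule less) (use 3 ij kl in auto)
  next
    case 4 show ?thesis unfolding swap12 by (rule less) (use 4 ij kl in auto)
  qed
qed

text \<open>A second peripheral eigenvalue forces a zero diagonal. If \<open>m\<close> is the last element of the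
  order and \<open>i\<close>, \<open>j\<close> are such that the entries \<open>(i, m)\<close> and \<open>(m, j)\<close> do not vanish, then
  the minor with rows \<open>i, m\<close> and columns \<open>m, j\<close> is the product of these entries, but has the
  wrong sign.\<close>

lemma not_linear_order_of_peripheral:
  assumes z: "z \<in># eigvals A" "cmod z = rho A" "z \<noteq> of_real (rho A)"
  shows "\<not> linear_order_on {..<n} (W_hat n J Jt)"
proof
  let ?W = "W_hat n J Jt" and ?B = "sign_conj J A"
  assume lin: "linear_order_on {..<n} ?W"
  hence trans: "trans ?W" and antisym: "antisym ?W" and total: "total_on {..<n} ?W"
    by (auto simp: linear_order_on_def partial_order_on_def preorder_on_def)
  obtain x where x: "is_eigenfun ?B z x"
    using z(1) in_eigvals_iff[OF B.carrier] eigvals_B by auto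
  \<comment> \<open>A nonzero diagonal entry links \<open>i\<close> to itself, so the phase of
    \<open>x i\<close> would be unchanged by the factor \<open>z / rho A\<close>, forcing
    \<open>z = rho A\<close>.\<close>
  have diag: "?B $$ (i, i) = 0" if "i < n" for i
  proof (rule ccontr)
    assume "?B $$ (i, i) \<noteq> 0"
    from B.peripheral_phase[OF x _ that that this] z(2)
    have "of_real (rho A) * (cmod (x i) * x i) = z * (cmod (x i) * x i)"
      by (simp add: rho_B mult_ac)
    moreover have "x i \<noteq> 0"
      using B.cmod_peripheral_eigenfun(2)[OF x] z(2) that by (simp add: rho_B)
    ultimately show False using z(3) by simp
  qed
  \<comment> \<open>The number of predecessors; the index that maximizes it is the last element of
    the order.\<close>
  define f where "f = (\<lambda>j. card {i. (i, j) \<in> ?W})"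
  have fin: "finite {i. (i, j) \<in> ?W}" for j
    by (rule finite_subset[of _ "{..<n}"]) (auto simp: W_hat_def)
  have "Max (f ` {..<n}) \<in> f ` {..<n}"
    using B.n_pos by (intro Max_in) auto
  then obtain m where m: "m < n" "f m = Max (f ` {..<n})" by auto
  have last: "(j, m) \<in> ?W" if j: "j < n" "j \<noteq> m" for j
  proof (rule ccontr)
    assume nW: "(j, m) \<notin> ?W"
    hence mj: "(m, j) \<in> ?W"
      using total j m(1) by (auto simp: total_on_def)
    hence "{i. (i, m) \<in> ?W} \<subseteq> {i. (i, j) \<in> ?W}"
      using trans by (auto elim: transE)
    moreover have "(j, j) \<in> ?W" using j by (simp add: W_hat_def)
    ultimately have "{i. (i, m) \<in> ?W} \<subset> {i. (i, j) \<in> ?W}"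
      using nW by auto
    hence "f m < f j"
      unfolding f_def by (rule psubset_card_mono[OF fin])
    moreover have "f j \<le> f m" unfolding m(2) using j by auto
    ultimately show False by simp
  qed
  obtain i j where i: "i < n" "?B $$ (i, m) \<noteq> 0" and j: "j < n" "?B $$ (m, j) \<noteq> 0"
    using B.row_nonzero[OF m(1)] B.col_nonzero[OF m(1)] by blast
  have "i \<noteq> m" "j \<noteq> m" using diag m(1) i j by auto
  have "0 < ?B $$ (i, m) * ?B $$ (m, j)"
    using i j m B.nonneg[of i m] B.nonneg[of m j] by simp
  moreover have "orient i m = - 1" "orient m j = 1"
    using last[OF i(1) \<open>i \<noteq> m\<close>] last[OF j(1) \<open>j \<noteq> m\<close>] \<open>i \<noteq> m\<close> \<open>j \<noteq> m\<close> orient_swap[of m j]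
    by (auto simp: W_hat_iff_orient)
  moreover have "0 \<le> orient i m * orient m j * (?B $$ (i, m) * ?B $$ (m, j))"
    using oriented_minor_nonneg[of i m m j] i j m \<open>i \<noteq> m\<close> \<open>j \<noteq> m\<close> diag by simp
  ultimately show False by simp
qed

text \<open>The wedge of the Perron vector \<open>u\<close> with an eigenvector \<open>v\<close> for the second eigenvalue is a
  Perron vector of the compound matrix up to signs; hence \<open>W_hat\<close> is the order by \<open>v / u\<close>.\<close>

lemma linear_order_of_second_eigenvalue:
  assumes r: "of_real r \<in># eigvals A" "r \<noteq> rho A" and rho2: "rho A2 = rho A * r"
  shows "linear_order_on {..<n} (W_hat n J Jt)"
proof -
  let ?B = "sign_conj J A" and ?C = "sign_conj Jt A2"
  obtain u where u: "\<And>i. i < n \<Longrightarrow> 0 < u i" "\<And>i. i < n \<Longrightarrow> mat_act ?B u i = rho A * u i"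
    using B.perron_vector by (metis rho_B)
  obtain x where x: "is_eigenfun ?B (of_real r) x"
    using r(1) in_eigvals_iff[OF B.carrier] eigvals_B by auto
  \<comment> \<open>As \<open>r\<close> is real, the real and imaginary parts of \<open>x\<close>
    satisfy the eigenvalue equation separately, and one of them is nonzero.\<close>
  have "mat_act ?B (\<lambda>j. Re (x j)) i = r * Re (x i) \<and> mat_act ?B (\<lambda>j. Im (x j)) i = r * Im (x i)"
    if "i < n" for i
  proof -
    have "mat_act ?B x i = of_real r * x i" using x that by (simp add: is_eigenfun_def)
    hence "Re (mat_act ?B x i) = r * Re (x i)" "Im (mat_act ?B x i) = r * Im (x i)" by auto
    thus ?thesis by (simp add: mat_act_def)
  qed
  moreover have "(\<exists>i<n. Re (x i) \<noteq> 0) \<or> (\<exists>i<n. Im (x i) \<noteq> 0)"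
    using x by (auto simp: is_eigenfun_def complex_eq_iff)
  ultimately obtain v where v: "\<exists>i<n. v i \<noteq> 0" "\<And>i. i < n \<Longrightarrow> mat_act ?B v i = r * v i"
    by meson
  define su sv where "su = (\<lambda>i. sign_of J i * u i)" "sv = (\<lambda>i. sign_of J i * v i)"
  define y where "y = (\<lambda>\<alpha>. sign_of Jt \<alpha> * wedge n su sv \<alpha>)"
  have su: "mat_act A su i = rho A * su i" and sv: "mat_act A sv i = r * sv i" if "i < n" for i
    using mat_act_sign_conj(2)[OF A that, of J] u(2) v(2) that by (simp_all add: su_sv_def)
  have y: "mat_act ?C y \<alpha> = rho A2 * y \<alpha>" if "\<alpha> < n choose 2" for \<alpha>
  proof -
    have "mat_act ?C y \<alpha> = sign_of Jt \<alpha> * wedge n (mat_act A su) (mat_act A sv) \<alpha>"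
      unfolding y_def
      using mat_act_sign_conj(1)[OF second_compound_carrier[OF A] that]
        mat_act_compound2_wedge[OF A that] by (simp add: second_compound_eq_compound2)
    thus ?thesis
      using index_pairs_nth[OF that]
      by (simp add: wedge_def su sv y_def rho2 algebra_simps)
  qed
  have y_entry: "y (pair_number n (i, j)) = orient i j * (u i * v j - u j * v i)"
    if "i < j" "j < n" for i j
    using pair_number[OF that] that
    by (simp add: y_def wedge_def su_sv_def orient_def min_def max_def algebra_simps)
  \<comment> \<open>A vanishing wedge would make \<open>u\<close> and \<open>v\<close> proportional,
    hence give them the same eigenvalue, against \<open>r \<noteq> rho A\<close>.\<close>
  have "\<exists>\<alpha><n choose 2. y \<alpha> \<noteq> 0"
  proof (rule ccontr)
    assume contr: "\<not> ?thesis"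
    have "u i * v j = u j * v i" if "i < j" "j < n" for i j
      using contr pair_number(1)[OF that] y_entry[OF that] orient_cases[of i j] by auto
    hence proportional: "u i * v j = u j * v i" if "i < n" "j < n" for i j
      using that by (metis linorder_neqE_nat)
    obtain i where i: "i < n" "v i \<noteq> 0" using v(1) by blast
    have "u i * (r * v i) = mat_act ?B (\<lambda>j. u i * v j) i"
      using v(2) i by (simp add: mat_act_mult)
    also have "\<dots> = mat_act ?B (\<lambda>j. v i * u j) i"
      using proportional i by (intro mat_act_cong) (simp add: mult.commute)
    also have "\<dots> = v i * (rho A * u i)"
      using u(2) i by (simp add: mat_act_mult)
    finally show False using i u(1)[OF i(1)] r(2) by simp
  qed
  with y have "is_eigenfun ?C (of_real (rho A2)) (\<lambda>\<alpha>. of_real (y \<alpha>))"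
    by (simp add: is_eigenfun_def mat_act_of_real)
  moreover obtain p where p: "\<And>\<alpha>. \<alpha> < n choose 2 \<Longrightarrow> 0 < p \<alpha>"
    "\<And>\<alpha>. \<alpha> < n choose 2 \<Longrightarrow> mat_act ?C p \<alpha> = rho A2 * p \<alpha>"
    using C.perron_vector by (metis rho_C)
  moreover have "is_eigenfun ?C (of_real (rho A2)) (\<lambda>\<alpha>. of_real (p \<alpha>))"
    using p(2) p(1)[OF choose_pos] choose_pos
    by (auto simp: is_eigenfun_def mat_act_of_real intro!: exI[of _ 0])
  moreover have "cmod (of_real (rho A2)) = rho ?C"
    using C.rho_pos by (simp add: rho_C)
  ultimately obtain c' where c': "\<forall>\<alpha><n choose 2. complex_of_real (y \<alpha>) = c' * of_real (p \<alpha>)"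
    using C.peripheral_eigenfun_unique by blast
  define c where "c = Re c'"
  have c: "y \<alpha> = c * p \<alpha>" if "\<alpha> < n choose 2" for \<alpha>
    using c' that by (auto simp: c_def complex_eq_iff)
  have "c \<noteq> 0" using \<open>\<exists>\<alpha><n choose 2. y \<alpha> \<noteq> 0\<close> c by auto
  \<comment> \<open>The factor \<open>c\<close> absorbs the undetermined sign of \<open>v\<close>:
    in the differences of \<open>t\<close> it appears as \<open>c\<^sup>2\<close>, so no case
    distinction is needed.\<close>
  define t where "t = (\<lambda>i. c * (v i / u i))"
  have pos: "0 < orient i j * (t j - t i)" if ij: "i < n" "j < n" "i < j" for i j
  proof -
    have "t j - t i = c * (u i * v j - u j * v i) / (u i * u j)"
      using u(1)[OF ij(1)] u(1)[OF ij(2)] by (simp add: t_def field_simps)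
    hence "orient i j * (t j - t i) = c * y (pair_number n (i, j)) / (u i * u j)"
      using y_entry ij by simp
    also have "\<dots> = c\<^sup>2 * p (pair_number n (i, j)) / (u i * u j)"
      using c pair_number(1) ij by (simp add: power2_eq_square)
    also have "\<dots> > 0"
      using p(1) pair_number(1) ij u(1) \<open>c \<noteq> 0\<close> by simp
    finally show ?thesis .
  qed
  have pos': "0 < orient i j * (t j - t i)" if ij: "i < n" "j < n" "i \<noteq> j" for i j
  proof (cases "i < j")
    case False
    hence "0 < orient j i * (t i - t j)" using pos ij by simp
    thus ?thesis using orient_swap[OF ij(3)] by (simp add: algebra_simps)
  qed (use pos ij in auto)
  have W: "(i, j) \<in> W_hat n J Jt \<longleftrightarrow> i < n \<and> j < n \<and> (i = j \<or> t j < t i)" for i j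
  proof (cases "i < n \<and> j < n \<and> i \<noteq> j")
    case True
    hence "0 < orient i j * (t j - t i)" using pos' by blast
    with True orient_cases[of i j] show ?thesis by (auto simp: W_hat_iff_orient)
  qed (auto simp: W_hat_iff_orient)
  have t_inj: "t i \<noteq> t j" if "i < n" "j < n" "i \<noteq> j" for i j
    using pos'[OF that] by auto
  show ?thesis
    unfolding linear_order_on_def partial_order_on_def preorder_on_def
  proof (intro conjI)
    show "W_hat n J Jt \<subseteq> {..<n} \<times> {..<n}" using W by auto
    show "refl_on {..<n} (W_hat n J Jt)" using W by (auto simp: refl_on_def)
    show "trans (W_hat n J Jt)" using W by (auto intro!: transI)
    show "antisym (W_hat n J Jt)" using W by (auto intro!: antisymI)
    show "total_on {..<n} (W_hat n J Jt)"
      using W t_inj by (auto simp: total_on_def) (meson linorder_neqE_linordered_idom)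
  qed
qed

section \<open>The possible peripheral spectra\<close>

lemma rho_pos: "0 < rho A" and rho2_pos: "0 < rho A2"
  using B.rho_pos C.rho_pos by (simp_all add: rho_B rho_C)

lemma peripheral_A:
  "filter_mset (\<lambda>z. cmod z = rho A) (eigvals A) =
     mset_set {z. z ^ h_index A = of_real (rho A ^ h_index A)}" "0 < h_index A"
  using B.peripheral_eigvals B.h_index_pos by (simp_all add: rho_B h_index_B eigvals_B)

lemma peripheral_A2:
  "filter_mset (\<lambda>z. cmod z = rho A2) (eigvals A2) =
     mset_set {z. z ^ h_index A2 = of_real (rho A2 ^ h_index A2)}" "0 < h_index A2"
  using C.peripheral_eigvals C.h_index_pos by (simp_all add: rho_C h_index_C eigvals_C)

lemma peripheral_simple_A2: "z \<in># eigvals A2 \<Longrightarrow> cmod z = rho A2 \<Longrightarrow> count (eigvals A2) z = 1"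
  using C.peripheral_simple by (simp add: rho_C eigvals_C)

lemma rho2_in_eigvals: "of_real (rho A2) \<in># eigvals A2"
  using C.rho_in_eigvals by (simp add: rho_C eigvals_C)

lemma cmod_le_rho: "z \<in># eigvals A \<Longrightarrow> cmod z \<le> rho A"
  by (rule cmod_eigvals_le_rho[OF A])

lemma cmod_le_rho2: "z \<in># eigvals A2 \<Longrightarrow> cmod z \<le> rho A2"
  by (rule cmod_eigvals_le_rho[OF second_compound_carrier[OF A]])

lemma eigvals_A2: "mset es = eigvals A \<Longrightarrow> eigvals A2 = mset (pair_products es)"
  using eigvals_compound2[OF A] by (simp add: second_compound_eq_compound2)

text \<open>Brings the peripheral eigenvalues to the front of a list, where
  \<open>pair_products\<close> unfolds on them.\<close>

lemma peripheral_split: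
  assumes ps: "mset ps = mset_set {z. z ^ h_index A = of_real (rho A ^ h_index A)}"
  obtains rest where "mset (ps @ rest) = eigvals A" "\<And>z. z \<in> set ps \<Longrightarrow> cmod z = rho A"
    "\<And>z. z \<in> set rest \<Longrightarrow> cmod z < rho A"
proof -
  obtain rest where rest: "mset rest = filter_mset (\<lambda>z. cmod z \<noteq> rho A) (eigvals A)"
    using ex_mset by blast
  have "mset (ps @ rest) = eigvals A"
    unfolding mset_append ps rest peripheral_A(1)[symmetric] by (rule multiset_partition[symmetric])
  moreover have "cmod z = rho A" if "z \<in> set ps" for z
  proof -
    have "z \<in># filter_mset (\<lambda>z. cmod z = rho A) (eigvals A)"
      using that unfolding peripheral_A(1) ps[symmetric] by simp
    thus ?thesis by simp
  qed
  moreover have "cmod z < rho A" if "z \<in> set rest" for z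
  proof -
    have "z \<in># filter_mset (\<lambda>z. cmod z \<noteq> rho A) (eigvals A)"
      using that unfolding rest[symmetric] by simp
    thus ?thesis using cmod_le_rho[of z] by auto
  qed
  ultimately show ?thesis by (rule that)
qed

text \<open>The product of two peripheral eigenvalues attains the bound valid for all products.
  Removing \<open>a\<close> before choosing \<open>b\<close> counts them with multiplicity.\<close>

lemma rho2_eq_square:
  assumes "a \<in># eigvals A" "b \<in># eigvals A - {#a#}" "cmod a = rho A" "cmod b = rho A"
  shows "rho A2 = rho A * rho A"
proof (rule antisym)
  have "{#a, b#} \<subseteq># eigvals A"
    using assms by (simp add: insert_subset_eq_iff)
  then obtain rest where es: "mset (a # b # rest) = eigvals A"
    by (metis ex_mset mset.simps(2) subset_mset.add_diff_inverse add_mset_add_single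
        union_mset_add_mset_left add_0)
  have "of_real (rho A2) \<in> set (pair_products (a # b # rest))"
    using rho2_in_eigvals unfolding eigvals_A2[OF es] by simp
  moreover have "cmod z \<le> rho A" if "z \<in> set (a # b # rest)" for z
    using cmod_le_rho that unfolding es[symmetric] by simp
  ultimately have "cmod (of_real (rho A2)) \<le> rho A * rho A"
    by (rule cmod_pair_products_le)
  thus "rho A2 \<le> rho A * rho A" using rho2_pos by simp
  have "a * b \<in># eigvals A2" unfolding eigvals_A2[OF es] by simp
  from cmod_le_rho2[OF this] show "rho A * rho A \<le> rho A2"
    using assms by (simp add: norm_mult)
qed

text \<open>With four peripheral eigenvalues \<open>\<rho> \<omega>\<^sup>k\<close>, the eigenvalue
  \<open>\<rho>\<omega>\<^sup>0 \<sqdot> \<rho>\<omega>\<^sup>3 = \<rho>\<omega>\<^sup>1 \<sqdot> \<rho>\<omega>\<^sup>2\<close> of the compound matrix would not be simple.\<close>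

lemma h_index_less_4: "h_index A < 4"
proof (rule ccontr)
  assume "\<not> h_index A < 4"
  hence h: "4 \<le> h_index A" by simp
  define h where "h = h_index A"
  define z where "z = (\<lambda>k. of_real (rho A) * cis (2 * pi * real k / real h))"
  have "inj_on (\<lambda>k. cis (2 * pi * real k / real h)) {..<h}"
    using bij_betw_roots_unity[of h] h by (simp add: bij_betw_def h_def)
  hence "inj_on z {..<h}"
    using rho_pos by (auto simp: inj_on_def z_def)
  hence inj: "z i = z j \<longleftrightarrow> i = j" if "i < 4" "j < 4" for i j
    using that h by (auto simp: inj_on_def h_def)
  have fin: "finite {z. z ^ h = complex_of_real (rho A ^ h)}"
    using peripheral_A(2) by (intro finite_nth_roots) (simp add: h_def)
  have root: "z k ^ h = of_real (rho A ^ h)" for k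
    using h by (simp add: z_def power_mult_distrib Complex.DeMoivre h_def)
  define es where "es = [z 0, z 1, z 2, z 3]"
  have "distinct es" by (simp add: es_def inj)
  hence "mset es = mset_set (set es)" by (simp add: mset_set_set)
  also have "\<dots> \<subseteq># mset_set {z. z ^ h = of_real (rho A ^ h)}"
    using fin root by (intro subset_imp_msubset_mset_set) (auto simp: es_def)
  also have "\<dots> \<subseteq># eigvals A"
    unfolding h_def peripheral_A(1)[symmetric] by (rule multiset_filter_subset)
  finally obtain rest where rest: "mset (es @ rest) = eigvals A"
    by (metis ex_mset mset_append subset_mset.add_diff_inverse)
  hence rest': "mset (z 0 # z 3 # z 1 # z 2 # rest) = eigvals A"
    by (simp add: es_def add_mset_commute)
  have cz: "cmod (z k) = rho A" for k using rho_pos by (simp add: z_def norm_mult)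
  have "rho A2 = rho A * rho A"
    by (rule rho2_eq_square[of "z 0" "z 3"]) (use cz in \<open>simp_all flip: rest'\<close>)
  moreover have "z 0 * z 3 \<in># eigvals A2" unfolding eigvals_A2[OF rest'] by simp
  ultimately have "count (eigvals A2) (z 0 * z 3) = 1"
    using cz by (intro peripheral_simple_A2) (auto simp: norm_mult)
  moreover have "z 1 * z 2 = z 0 * z 3"
    by (simp add: z_def cis_mult add_divide_distrib[symmetric])
  \<comment> \<open>The first two terms are equal, so their common value has multiplicity at least
    2; the rest is only spelled out to exhibit a remainder \<open>X\<close>.\<close>
  moreover have "eigvals A2 = {#z 0 * z 3, z 1 * z 2#} +
      ({#z 0 * z 1, z 0 * z 2, z 3 * z 1, z 3 * z 2#} + image_mset ((*) (z 0)) (mset rest) +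
       image_mset ((*) (z 3)) (mset rest) + image_mset ((*) (z 1)) (mset rest) +
       image_mset ((*) (z 2)) (mset rest) + mset (pair_products rest))"
    unfolding eigvals_A2[OF rest'] by (simp add: add_mset_commute)
  then obtain X where "eigvals A2 = {#z 0 * z 3, z 1 * z 2#} + X" by blast
  ultimately show False by simp
qed

lemma h_index_neq_2: "h_index A \<noteq> 2"
proof
  assume h: "h_index A = 2"
  let ?r = "complex_of_real (rho A)"
  have "{z. z ^ h_index A = of_real (rho A ^ h_index A)} = {?r, - ?r}"
    by (auto simp: h power2_eq_iff)
  hence "mset [?r, - ?r] = mset_set {z. z ^ h_index A = of_real (rho A ^ h_index A)}"
    using rho_pos by simp
  then obtain rest where rest: "mset ([?r, - ?r] @ rest) = eigvals A"
    "\<And>z. z \<in> set rest \<Longrightarrow> cmod z < rho A"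
    by (rule peripheral_split) blast
  have "rho A2 = rho A * rho A"
    by (rule rho2_eq_square[of ?r "- ?r"]) (use rho_pos in \<open>simp_all flip: rest(1)\<close>)
  moreover have "of_real (rho A2) \<in> set (pair_products ([?r, - ?r] @ rest))"
    using rho2_in_eigvals unfolding eigvals_A2[OF rest(1)] by simp
  ultimately have mem: "?r * ?r \<in> set (pair_products ([?r, - ?r] @ rest))" by simp
  have "?r * ?r \<notin> set (pair_products rest)"
    using cmod_pair_products_less[of "?r * ?r" rest "rho A"] rest(2) by (auto simp: norm_mult)
  moreover have "?r * ?r \<noteq> ?r * x \<and> ?r * ?r \<noteq> - ?r * x" if "x \<in> set rest" for x
  proof -
    have "cmod (?r * x) < cmod (?r * ?r)" using rest(2)[OF that] rho_pos by (simp add: norm_mult)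
    moreover from this have "cmod (- ?r * x) < cmod (?r * ?r)" by (simp add: norm_mult)
    ultimately show ?thesis by (metis order_less_irrefl)
  qed
  ultimately show False using mem rho_pos by auto
qed

text \<open>Three peripheral eigenvalues have three pairwise products of maximal modulus, and any
  product with another factor is smaller.\<close>

lemma h_index_3_imp:
  assumes h: "h_index A = 3"
  shows "h_index A2 = 3"
proof -
  have "\<exists>ps. mset ps = mset_set {z. z ^ h_index A = complex_of_real (rho A ^ h_index A)}"
    by (rule ex_mset)
  then obtain ps where ps: "mset ps = mset_set {z. z ^ h_index A = complex_of_real (rho A ^ h_index A)}"
    by blast
  obtain rest where rest: "mset (ps @ rest) = eigvals A" "\<And>z. z \<in> set ps \<Longrightarrow> cmod z = rho A"
    "\<And>z. z \<in> set rest \<Longrightarrow> cmod z < rho A"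
    using peripheral_split[OF ps] by blast
  have "length ps = size (mset ps)" by simp
  also have "\<dots> = 3"
    unfolding ps peripheral_A(1)[symmetric] using h by (simp add: h_index_def)
  finally obtain a b c where abc: "ps = [a, b, c]"
    by (auto simp: numeral_3_eq_3 length_Suc_conv)
  have rho2: "rho A2 = rho A * rho A"
    by (rule rho2_eq_square[of a b]) (use rest(2) in \<open>simp_all add: abc flip: rest(1)\<close>)
  have small: "cmod y \<noteq> rho A * rho A" if "y \<in> set (pair_products rest)" for y
    using cmod_pair_products_less[OF that rest(3)] by simp
  have small': "cmod y \<noteq> rho A" if "y \<in> set rest" for y
    using rest(3)[OF that] by simp
  have "h_index A2 = length (filter (\<lambda>z. cmod z = rho A * rho A) (pair_products (ps @ rest)))"
    unfolding h_index_def eigvals_A2[OF rest(1)] rho2 by (metis mset_filter size_mset)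
  also have "\<dots> = 3"
    using rest(2) small small' rho_pos
    by (auto simp: abc norm_mult filter_empty_conv o_def filter_map)
  finally show ?thesis .
qed

text \<open>Products without the factor \<open>rho A\<close> have modulus at most
  \<open>r * r < rho A * r\<close>. So the outer circle of the compound is, with multiplicities,
  \<open>rho A\<close> times the circle of radius \<open>r\<close>, and division by
  \<open>rho A\<close> carries the root equation over.\<close>

lemma second_circle:
  assumes h: "h_index A = 1"
  obtains r rest where "0 < r" "r < rho A" "rho A2 = rho A * r"
    "eigvals A = add_mset (of_real (rho A)) rest" "\<And>z. z \<in># rest \<Longrightarrow> cmod z \<le> r"
    "filter_mset (\<lambda>z. cmod z = r) rest = mset_set {z. z ^ h_index A2 = of_real (r ^ h_index A2)}"
proof -
  let ?\<rho> = "complex_of_real (rho A)"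
  have "mset [?\<rho>] = mset_set {z. z ^ h_index A = of_real (rho A ^ h_index A)}"
    by (simp add: h)
  then obtain es where "mset ([?\<rho>] @ es) = eigvals A" and less: "\<And>z. z \<in> set es \<Longrightarrow> cmod z < rho A"
    by (rule peripheral_split) blast
  hence es: "mset (?\<rho> # es) = eigvals A" by simp
  have "size (eigvals A) = n" by (rule size_eigvals[OF A])
  hence "length es = n - 1" unfolding es[symmetric] by simp
  hence "es \<noteq> []" using n2 by auto
  define r where "r = Max (cmod ` set es)"
  have "r \<in> cmod ` set es" unfolding r_def using \<open>es \<noteq> []\<close> by (intro Max_in) auto
  then obtain x where x: "x \<in> set es" "r = cmod x" by auto
  have le: "cmod z \<le> r" if "z \<in> set es" for z unfolding r_def using that by auto
  have "r < rho A" "0 \<le> r" using x less by auto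
  have small: "cmod y \<le> r * r" if "y \<in> set (pair_products es)" for y
    using cmod_pair_products_le[OF that le] .
  have "r * r \<le> rho A * r" using \<open>r < rho A\<close> \<open>0 \<le> r\<close> by (intro mult_right_mono) auto
  have rho2: "rho A2 = rho A * r"
  proof (rule antisym)
    have "of_real (rho A2) \<in> set (map ((*) ?\<rho>) es) \<union> set (pair_products es)"
      using rho2_in_eigvals unfolding eigvals_A2[OF es] by simp
    hence "cmod (of_real (rho A2)) \<le> rho A * r"
    proof
      assume "of_real (rho A2) \<in> set (map ((*) ?\<rho>) es)"
      then obtain z where "z \<in> set es" "of_real (rho A2) = ?\<rho> * z" by auto
      thus ?thesis using le rho_pos by (simp add: norm_mult)
    next
      assume "of_real (rho A2) \<in> set (pair_products es)"
      thus ?thesis using small \<open>r * r \<le> rho A * r\<close> order_trans by blast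
    qed
    thus "rho A2 \<le> rho A * r" using rho2_pos by simp
    have "?\<rho> * x \<in># eigvals A2" unfolding eigvals_A2[OF es] using x(1) by auto
    from cmod_le_rho2[OF this] show "rho A * r \<le> rho A2"
      using x rho_pos by (simp add: norm_mult)
  qed
  \<comment> \<open>Positivity of \<open>r\<close> comes from the compound, whose spectral radius is
    positive by irreducibility.\<close>
  have "0 < r" using rho2_pos rho_pos by (simp add: rho2 zero_less_mult_iff)
  hence "r * r < rho A * r" using \<open>r < rho A\<close> by simp
  let ?G2 = "{z. z ^ h_index A2 = complex_of_real (rho A2 ^ h_index A2)}"
  let ?G = "{z. z ^ h_index A2 = complex_of_real (r ^ h_index A2)}"
  have "filter_mset (\<lambda>z. cmod z = rho A2) (mset (pair_products es)) = {#}"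
    using small \<open>r * r < rho A * r\<close> unfolding rho2 by fastforce
  hence "mset_set ?G2 = filter_mset (\<lambda>z. cmod z = rho A2) (image_mset ((*) ?\<rho>) (mset es))"
    unfolding peripheral_A2(1)[symmetric] eigvals_A2[OF es] by simp
  also have "\<dots> = image_mset ((*) ?\<rho>) (filter_mset (\<lambda>z. cmod z = r) (mset es))"
    using rho_pos by (simp add: filter_mset_image_mset norm_mult rho2)
  finally have "image_mset (\<lambda>z. z / ?\<rho>) (mset_set ?G2) =
      image_mset (\<lambda>z. z / ?\<rho>) (image_mset ((*) ?\<rho>) (filter_mset (\<lambda>z. cmod z = r) (mset es)))"
    by simp
  also have "\<dots> = filter_mset (\<lambda>z. cmod z = r) (mset es)"
    using rho_pos by (simp add: multiset.map_comp o_def)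
  also have "image_mset (\<lambda>z. z / ?\<rho>) (mset_set ?G2) = mset_set ((\<lambda>z. z / ?\<rho>) ` ?G2)"
    using rho_pos by (intro image_mset_mset_set) (auto simp: inj_on_def)
  also have "(\<lambda>z. z / ?\<rho>) ` ?G2 = ?G"
  proof -
    have "z \<in> (\<lambda>z. z / ?\<rho>) ` ?G2" if "z \<in> ?G" for z
      using that rho_pos
      by (intro image_eqI[of _ _ "?\<rho> * z"]) (auto simp: rho2 power_mult_distrib)
    thus ?thesis
      using rho_pos by (auto simp: rho2 power_mult_distrib power_divide)
  qed
  finally have "filter_mset (\<lambda>z. cmod z = r) (mset es) = mset_set ?G" ..
  from that[OF \<open>0 < r\<close> \<open>r < rho A\<close> rho2 _ _ this] es le show ?thesis by simp
qed

section \<open>Enumeration of the spectrum\<close>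

text \<open>The list consists of \<open>rho A\<close>, then \<open>r\<close>, then the other roots,
  then the remaining eigenvalues by decreasing modulus. The \<open>m\<close> roots thus occupy the
  places 2 to \<open>m + 1\<close>.\<close>

lemma eigenvalue_enumeration:
  assumes r: "r < rho A" "0 < r"
    and rest: "eigvals A = add_mset (of_real (rho A)) R" "\<And>z. z \<in># R \<Longrightarrow> cmod z \<le> r"
    and circle: "filter_mset (\<lambda>z. cmod z = r) R = mset_set {z. z ^ m = of_real (r ^ m)}"
    and m: "0 < m"
  shows "\<exists>lam. image_mset lam (mset_set {1..n}) = eigvals A \<and>
    lam 1 = of_real (rho A) \<and> lam 2 = of_real r \<and>
    (\<forall>i\<in>{2..<n}. cmod (lam (Suc i)) \<le> cmod (lam i)) \<and>
    {i \<in> {1..n}. cmod (lam i) = r} = {2..m + 1} \<and>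
    lam ` {2..m + 1} = {z. z ^ m = of_real (r ^ m)}"
proof -
  let ?G = "{z. z ^ m = complex_of_real (r ^ m)}"
  have fin: "finite ?G" using m by (intro finite_nth_roots) auto
  have card: "card ?G = m" using m r by (intro card_nth_roots) auto
  obtain gs where gs: "mset gs = mset_set (?G - {of_real r})" using ex_mset by blast
  have "set_mset (mset gs) = ?G - {of_real r}" unfolding gs using fin by simp
  hence set_gs: "insert (of_real r) (set gs) = ?G" by auto
  have "mset (of_real r # gs) = mset_set ?G"
    using gs mset_set.remove[OF fin, of "of_real r"] by simp
  hence len_gs: "Suc (length gs) = m"
    using card by (metis length_Cons size_mset size_mset_set)
  obtain ts where ts: "mset ts = filter_mset (\<lambda>z. cmod z \<noteq> r) R" using ex_mset by blast
  \<comment> \<open>The key is negated because the sort is ascending.\<close>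
  define ss where "ss = sort_key (\<lambda>z. - cmod z) ts"
  have mset_ss: "mset ss = filter_mset (\<lambda>z. cmod z \<noteq> r) R" by (simp add: ss_def ts)
  define xs where "xs = of_real r # gs"
  have mset_xs: "mset xs = filter_mset (\<lambda>z. cmod z = r) R"
    using \<open>mset (of_real r # gs) = mset_set ?G\<close> circle by (simp add: xs_def)
  have len_xs: "length xs = m" using len_gs by (simp add: xs_def)
  have xs: "cmod z = r" if "z \<in> set xs" for z
  proof -
    have "z \<in># mset xs" using that by simp
    thus ?thesis unfolding mset_xs by simp
  qed
  have ss: "cmod z < r" if "z \<in> set ss" for z
  proof -
    have "z \<in># mset ss" using that by simp
    thus ?thesis unfolding mset_ss using rest(2)[of z] by auto
  qed
  define es where "es = of_real (rho A) # xs @ ss"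
  have es: "mset es = eigvals A"
    unfolding es_def by (simp add: mset_xs mset_ss rest(1) multiset_partition[symmetric])
  have len: "length es = n" unfolding size_mset[symmetric] es by (rule size_eigvals[OF A])
  hence n: "n = 1 + m + length ss" using len_xs by (simp add: es_def)
  \<comment> \<open>The enumeration starts at 1, lists at 0; below, \<open>xs @ ss\<close> is
    shifted by 2 since \<open>rho A\<close> precedes it.\<close>
  define lam where "lam = (\<lambda>i. es ! (i - 1))"
  have "map lam [1..<Suc n] = es"
    using len by (intro nth_equalityI) (auto simp: lam_def simp del: upt_Suc)
  moreover have "mset_set {1..n} = mset [1..<Suc n]"
    by (simp add: atLeastLessThanSuc_atLeastAtMost[symmetric] del: upt_Suc)
  ultimately have 1: "image_mset lam (mset_set {1..n}) = eigvals A"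
    unfolding es[symmetric] by (metis mset_map)
  have 2: "lam 1 = of_real (rho A)" "lam 2 = of_real r"
    by (simp_all add: lam_def es_def xs_def)
  have sorted: "sorted_wrt (\<lambda>x y. cmod y \<le> cmod x) (xs @ ss)"
  proof -
    have "sorted_wrt (\<lambda>x y. cmod y \<le> cmod x) xs'" if "\<And>z. z \<in> set xs' \<Longrightarrow> cmod z = r" for xs'
      using that by (induction xs') auto
    moreover have "sorted (map (\<lambda>z. - cmod z) ss)" by (simp add: ss_def)
    hence "sorted_wrt (\<lambda>x y. cmod y \<le> cmod x) ss" by (simp add: sorted_map)
    ultimately show ?thesis
      using xs ss by (fastforce simp: sorted_wrt_append)
  qed
  have 3: "cmod (lam (Suc i)) \<le> cmod (lam i)" if i: "i \<in> {2..<n}" for i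
  proof -
    have "cmod ((xs @ ss) ! (i - 1)) \<le> cmod ((xs @ ss) ! (i - 2))"
      using i len by (intro sorted_wrt_nth_less[OF sorted]) (auto simp: es_def)
    moreover have "lam (Suc i) = (xs @ ss) ! (i - 1)" "lam i = (xs @ ss) ! (i - 2)"
      using i by (auto simp: lam_def es_def nth_Cons' numeral_2_eq_2)
    ultimately show ?thesis by simp
  qed
  have lam_xs: "lam i = xs ! (i - 2)" if "i \<in> {2..m + 1}" for i
    using that len_xs by (auto simp: lam_def es_def nth_Cons' nth_append numeral_2_eq_2)
  have lam_ss: "lam i = ss ! (i - 2 - m)" if "m + 1 < i" for i
    using that len_xs m by (auto simp: lam_def es_def nth_Cons' nth_append numeral_2_eq_2)
  have 4: "{i \<in> {1..n}. cmod (lam i) = r} = {2..m + 1}"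
  proof (intro equalityI subsetI)
    fix i assume i: "i \<in> {i \<in> {1..n}. cmod (lam i) = r}"
    have "i \<noteq> 1" using i 2(1) r by auto
    moreover have "\<not> m + 1 < i"
    proof
      assume "m + 1 < i"
      moreover from this have "i - 2 - m < length ss" using i n by auto
      ultimately show False using lam_ss[of i] ss[of "lam i"] i by auto
    qed
    ultimately show "i \<in> {2..m + 1}" using i by auto
  next
    fix i assume i: "i \<in> {2..m + 1}"
    hence "lam i \<in> set xs" using lam_xs[OF i] len_xs by auto
    thus "i \<in> {i \<in> {1..n}. cmod (lam i) = r}" using xs i n by auto
  qed
  have "lam ` {2..m + 1} = (\<lambda>k. xs ! k) ` {..<m}"
  proof -
    have "(\<lambda>k. k + 2) ` {..<m} = {2..m + 1}"
    proof (intro equalityI subsetI)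
      fix i assume "i \<in> {2..m + 1}"
      thus "i \<in> (\<lambda>k. k + 2) ` {..<m}" by (intro image_eqI[of _ _ "i - 2"]) auto
    qed auto
    hence "lam ` {2..m + 1} = (\<lambda>k. lam (k + 2)) ` {..<m}" by (metis image_image)
    also have "\<dots> = (\<lambda>k. xs ! k) ` {..<m}" using lam_xs by (intro image_cong) auto
    finally show ?thesis .
  qed
  also have "\<dots> = set xs" using len_xs by (auto simp: set_conv_nth)
  also have "\<dots> = ?G" using set_gs by (simp add: xs_def)
  finally have 5: "lam ` {2..m + 1} = ?G" .
  show ?thesis
    by (intro exI[of _ lam] conjI ballI 1 2 3 4 5)
qed

lemma h_index_cases: "h_index A = 1 \<or> h_index A = 3"
  using h_index_less_4 h_index_neq_2 peripheral_A(2) by linarith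

lemma set_peripheral_A:
  "{z \<in> set_mset (eigvals A). cmod z = rho A} = {z. z ^ h_index A = of_real (rho A ^ h_index A)}"
proof -
  have "{z \<in> set_mset (eigvals A). cmod z = rho A} =
      set_mset (filter_mset (\<lambda>z. cmod z = rho A) (eigvals A))"
    by auto
  also have "\<dots> = {z. z ^ h_index A = of_real (rho A ^ h_index A)}"
    unfolding peripheral_A(1) using peripheral_A(2) by (simp add: finite_nth_roots)
  finally show ?thesis .
qed

lemma peripheral_simple_A: "z \<in># eigvals A \<Longrightarrow> cmod z = rho A \<Longrightarrow> count (eigvals A) z = 1"
  using B.peripheral_simple by (simp add: rho_B eigvals_B)

lemma not_linear_order_of_h_index_3:
  assumes h: "h_index A = 3"
  shows "\<not> linear_order_on {..<n} (W_hat n J Jt)"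
proof -
  have card: "card {z \<in> set_mset (eigvals A). cmod z = rho A} = 3"
    unfolding set_peripheral_A h using rho_pos by (intro card_nth_roots) auto
  have "\<not> {z \<in> set_mset (eigvals A). cmod z = rho A} \<subseteq> {of_real (rho A)}"
  proof
    assume "{z \<in> set_mset (eigvals A). cmod z = rho A} \<subseteq> {of_real (rho A)}"
    from card_mono[OF _ this] show False unfolding card by simp
  qed
  then obtain z where "z \<in># eigvals A" "cmod z = rho A" "z \<noteq> of_real (rho A)"
    by auto
  thus ?thesis by (rule not_linear_order_of_peripheral)
qed

end

theorem theorem15:
  fixes n :: nat and A :: "real mat" and J Jt :: "nat set"
  assumes n: "n \<ge> 2"
    and A: "A \<in> carrier_mat n n"
    and sym_A: "J_sign_symmetric A"
    and irr_A: "irreducible_mat A"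
    and sym_A2: "J_sign_symmetric (second_compound A)"
    and irr_A2: "irreducible_mat (second_compound A)"
    and J: "sign_symmetric_witness A J"
    and Jt: "sign_symmetric_witness (second_compound A) Jt"
  shows
    "(linear_order_on {..<n} (W_hat n J Jt) \<and>
      h_index A = 1 \<and>
      (\<exists>(lam :: nat \<Rightarrow> complex) (l1 :: real) (l2 :: real).
         image_mset lam (mset_set {1..n}) = eigvals A \<and>
         lam 1 = complex_of_real l1 \<and> lam 2 = complex_of_real l2 \<and>
         0 < l1 \<and> 0 < l2 \<and>
         simple_eigenvalue A (lam 1) \<and> simple_eigenvalue A (lam 2) \<and>
         rho A = l1 \<and> l1 > l2 \<and>
         (\<forall>i\<in>{2..<n}. cmod (lam i) \<ge> cmod (lam (Suc i))) \<and>
         (h_index A = 1 \<and> h_index (second_compound A) = 1 \<longrightarrow>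
            (\<forall>i\<in>{1..n} - {2}. cmod (lam i) \<noteq> l2)) \<and>
         (h_index A = 1 \<and> h_index (second_compound A) > 1 \<longrightarrow>
            {i \<in> {1..n}. cmod (lam i) = l2} = {2..h_index (second_compound A) + 1} \<and>
            (\<forall>i\<in>{2..h_index (second_compound A) + 1}. simple_eigenvalue A (lam i)) \<and>
            lam ` {2..h_index (second_compound A) + 1} =
              {z. z ^ h_index (second_compound A) = complex_of_real (l2 ^ h_index (second_compound A))})))
     \<or>
     (\<not> linear_order_on {..<n} (W_hat n J Jt) \<and>
      h_index A = 3 \<and> h_index (second_compound A) = 3 \<and>
      card {z \<in> set_mset (eigvals A). cmod z = rho A} = 3 \<and>
      (\<forall>z\<in>{z \<in> set_mset (eigvals A). cmod z = rho A}. simple_eigenvalue A z) \<and>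
      {z \<in> set_mset (eigvals A). cmod z = rho A} = {z. z ^ 3 = complex_of_real (rho A ^ 3)})"
proof -
  interpret sign_symmetric_compound n A J Jt
    using n A irr_A irr_A2 J Jt by unfold_locales
  \<comment> \<open>The cases are on \<open>h_index A\<close> rather than on the order, because each
    of its two values decides whether \<open>W_hat\<close> is linear.\<close>
  show ?thesis
    using h_index_cases
  proof
    assume h: "h_index A = 1"
    obtain r R where r: "0 < r" "r < rho A" "rho A2 = rho A * r"
      and R: "eigvals A = add_mset (of_real (rho A)) R" "\<And>z. z \<in># R \<Longrightarrow> cmod z \<le> r"
      and circle: "filter_mset (\<lambda>z. cmod z = r) R =
        mset_set {z. z ^ h_index A2 = of_real (r ^ h_index A2)}"
      using second_circle[OF h] by metis
    have fin: "finite {z. z ^ h_index A2 = complex_of_real (r ^ h_index A2)}"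
      using peripheral_A2(2) by (intro finite_nth_roots)
    \<comment> \<open>Simplicity within \<open>R\<close> carries over to the whole spectrum, as
      \<open>z\<close> has modulus \<open>r < rho A\<close> and so differs from the eigenvalue split
      off.\<close>
    have simple: "count (eigvals A) z = 1" if "z ^ h_index A2 = of_real (r ^ h_index A2)" for z
    proof -
      have "count (filter_mset (\<lambda>z. cmod z = r) R) z = 1"
        unfolding circle using that fin by simp
      hence "cmod z = r" "count R z = 1" by (auto split: if_splits)
      thus ?thesis using r rho_pos by (auto simp: R(1))
    qed
    \<comment> \<open>The number \<open>r\<close> is itself a root of \<open>z ^ h = r ^ h\<close>,
      which places a positive real eigenvalue on the second circle.\<close>
    have "count (filter_mset (\<lambda>z. cmod z = r) R) (of_real r) = 1"
      unfolding circle using fin by simp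
    hence "of_real r \<in># R"
      by (metis count_filter_mset count_greater_zero_iff zero_neq_one not_gr_zero)
    hence lin: "linear_order_on {..<n} (W_hat n J Jt)"
      using r by (intro linear_order_of_second_eigenvalue[of r]) (auto simp: R(1))
    obtain lam where lam: "image_mset lam (mset_set {1..n}) = eigvals A"
      "lam 1 = of_real (rho A)" "lam 2 = of_real r"
      "\<forall>i\<in>{2..<n}. cmod (lam (Suc i)) \<le> cmod (lam i)"
      "{i \<in> {1..n}. cmod (lam i) = r} = {2..h_index A2 + 1}"
      "lam ` {2..h_index A2 + 1} = {z. z ^ h_index A2 = of_real (r ^ h_index A2)}"
      using eigenvalue_enumeration[OF r(2,1) R circle peripheral_A2(2)] by blast
    have simple_lam: "count (eigvals A) (lam i) = 1" if "i \<in> {2..h_index A2 + 1}" for i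
      using lam(6) that by (intro simple) blast
    have "count (eigvals A) (lam 1) = 1"
      unfolding lam(2) using rho_pos by (intro peripheral_simple_A) (auto simp: R(1))
    moreover have "count (eigvals A) (lam 2) = 1"
      using peripheral_A2(2) by (intro simple_lam) auto
    moreover have "\<forall>i\<in>{1..n} - {2}. cmod (lam i) \<noteq> r" if "h_index A2 = 1"
    proof -
      have "{i \<in> {1..n}. cmod (lam i) = r} = {2}" using lam(5) that by auto
      thus ?thesis by blast
    qed
    ultimately show ?thesis
      using lin h lam r rho_pos simple_lam
      by (intro disjI1 conjI exI[of _ lam] exI[of _ "rho A"] exI[of _ r] impI ballI) simp_all
  next
    assume h: "h_index A = 3"
    have "card {z \<in> set_mset (eigvals A). cmod z = rho A} = 3"
      unfolding set_peripheral_A h using rho_pos by (intro card_nth_roots) auto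
    moreover have "{z \<in> set_mset (eigvals A). cmod z = rho A} = {z. z ^ 3 = of_real (rho A ^ 3)}"
      using set_peripheral_A by (simp only: h)
    ultimately show ?thesis
      using not_linear_order_of_h_index_3[OF h] h_index_3_imp[OF h] h peripheral_simple_A
      by (intro disjI2 conjI ballI) auto
  qed
qed

end
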